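(* Let $\mathbb{K}$ be a field of characteristic zero. Let $d$ and $m=d-1$ be positive integers and let $P_1,\dots,P_s$ be pairwise distinct points in $\mathbb{P}^2=\mathbb{P}^2(\mathbb{K})$, where $s=\binom{d+2}{2}-\binom{d}{2}+1$. Let $Z=\{P_1,\dots,P_s\}$, assume that $Z$ imposes independent conditions on forms of degree $d$, and for a line $L\subset\mathbb{P}^2$ let $|L|$ denote the number of points of $Z\cap L$. If $$\sum_{L_i}\binom{|L_i|-1}{2}+d-s+2>2\binom{d}{2},$$ where the sum is over all lines $L_i$ such that $Z\cap L_i\neq\emptyset$ and $|L_i|\geq 3$, then $Z$ admits an unexpected curve of type $(d,d-1)$.
   Context: $Z$ imposes independent conditions on forms of degree $d$ if the vector space $[I_Z]_d$ of forms of degree $d$ vanishing on $Z$ has dimension $\binom{d+2}{2}-|Z|$. A finite set $Z\subset\mathbb{P}^2$ imposing independent conditions on forms of degree $d$ admits an unexpected curve of type $(d,m)$ if, for a general point $B\in\mathbb{P}^2$, the vector space of forms of degree $d$ that vanish on $Z$ and vanish to order at least $m$ at $B$ has dimension strictly greater than $\max\left(0,\dim[I_Z]_d-\binom{m+1}{2}\right)$. "General" means: for all $B$ in some nonempty Zariski open subset. *)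

theory Defs
  imports "HOL-Analysis.Analysis" "HOL-Library.Poly_Mapping"
begin

text \<open>Polynomials in three variables, indexed by the three-element type \<open>3\<close>: finitely supported
  maps from exponent vectors to coefficients, with the ring structure of \<open>Poly_Mapping\<close>.\<close>

type_synonym 'a tpoly = "(3 \<Rightarrow>\<^sub>0 nat) \<Rightarrow>\<^sub>0 'a"

definition tp_scale :: "'a::field \<Rightarrow> 'a tpoly \<Rightarrow> 'a tpoly" where
  "tp_scale c F = Poly_Mapping.single 0 c * F"

interpretation tp: vector_space "tp_scale :: 'a::field \<Rightarrow> 'a tpoly \<Rightarrow> 'a tpoly"
  by unfold_locales
    (simp_all add: tp_scale_def algebra_simps single_add mult_single flip: mult.assoc)

definition tp_eval :: "'a::field tpoly \<Rightarrow> 'a ^ 3 \<Rightarrow> 'a" where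
  "tp_eval F v = (\<Sum>e \<in> Poly_Mapping.keys F. Poly_Mapping.lookup F e * (\<Prod>i\<in>UNIV. (v $ i) ^ Poly_Mapping.lookup e i))"

definition tp_deriv :: "3 \<Rightarrow> 'a::field tpoly \<Rightarrow> 'a tpoly" where
  "tp_deriv i F = (\<Sum>e \<in> Poly_Mapping.keys F.
     Poly_Mapping.single (e - Poly_Mapping.single i 1) (of_nat (Poly_Mapping.lookup e i) * Poly_Mapping.lookup F e))"

definition forms :: "nat \<Rightarrow> 'a::field tpoly set" where
  "forms d = {F. \<forall>e \<in> Poly_Mapping.keys F. (\<Sum>i\<in>UNIV. Poly_Mapping.lookup e i) = d}"

text \<open>A point of the projective plane is a one-dimensional subspace of the coordinate space; its
  nonzero vectors are its homogeneous coordinate vectors. A line is the set of all points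
  contained in a two-dimensional subspace.\<close>

definition proj_plane :: "('a::field ^ 3) set set" where
  "proj_plane = {P. vec.subspace P \<and> vec.dim P = 1}"

definition proj_lines :: "('a::field ^ 3) set set set" where
  "proj_lines = {{P \<in> proj_plane. P \<subseteq> W} |W. vec.subspace W \<and> vec.dim W = 2}"

definition vanishes_at :: "'a::field tpoly \<Rightarrow> ('a ^ 3) set \<Rightarrow> bool" where
  "vanishes_at F P \<longleftrightarrow> (\<forall>v \<in> P - {0}. tp_eval F v = 0)"

text \<open>All partial derivatives of order less than \<open>m\<close>, including the form itself (order 0), vanish
  at the point. This is the order of vanishing in characteristic zero only. Each list enumerates
  the variables with respect to which one differentiates.\<close>

definition vanishes_to_order :: "nat \<Rightarrow> 'a::field_char_0 tpoly \<Rightarrow> ('a ^ 3) set \<Rightarrow> bool" where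
  "vanishes_to_order m F B \<longleftrightarrow> (\<forall>is. length is < m \<longrightarrow> vanishes_at (fold tp_deriv is F) B)"

definition zariski_open :: "('a::field ^ 3) set set \<Rightarrow> bool" where
  "zariski_open U \<longleftrightarrow>
     (\<exists>S \<subseteq> (\<Union>e. forms e). U = {B \<in> proj_plane. \<exists>F \<in> S. \<not> vanishes_at F B})"

definition forms_vanishing_on :: "nat \<Rightarrow> ('a::field ^ 3) set set \<Rightarrow> 'a tpoly set" where
  "forms_vanishing_on d Z = {F \<in> forms d. \<forall>P \<in> Z. vanishes_at F P}"

definition imposes_independent_conditions :: "('a::field ^ 3) set set \<Rightarrow> nat \<Rightarrow> bool" where
  "imposes_independent_conditions Z d \<longleftrightarrow>
     int (tp.dim (forms_vanishing_on d Z)) = int ((d + 2) choose 2) - int (card Z)"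

definition admits_unexpected_curve ::
  "('a::field_char_0 ^ 3) set set \<Rightarrow> nat \<Rightarrow> nat \<Rightarrow> bool" where
  "admits_unexpected_curve Z d m \<longleftrightarrow>
     (\<exists>U. zariski_open U \<and> U \<noteq> {} \<and>
       (\<forall>B \<in> U. int (tp.dim {F \<in> forms_vanishing_on d Z. vanishes_to_order m F B})
          > max 0 (int (tp.dim (forms_vanishing_on d Z)) - int ((m + 1) choose 2))))"

end

theory Submission
  imports Defs "Jordan_Normal_Form.Determinant"
begin

text \<open>
  Write \<open>n = 2 d + 2\<close> for the number of points. Independence of the conditions makes the expected
  dimension negative and the numerical hypothesis reads \<open>d\<^sup>2 < (\<Sum>L. (|L| - 1) choose 2)\<close>, so one has to
  produce, for general \<open>B\<close>, one nonzero form of degree \<open>d\<close> that vanishes on \<open>Z\<close> and to order \<open>d - 1\<close>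
  at \<open>B\<close>.

  Let \<open>B\<close> lie on no line through two points of \<open>Z\<close>, and take a general line through \<open>B\<close> as the line at
  infinity. Then \<open>Z\<close> consists of \<open>n\<close> affine points \<open>(a\<^sub>i, b\<^sub>i)\<close> with distinct \<open>b\<^sub>i\<close>, the point \<open>B\<close> is the
  direction of the horizontal lines, and the lines \<open>L\<close> of the hypothesis have pairwise distinct slopes
  \<open>\<tau>\<^sub>L\<close>. The wanted forms are the polynomials \<open>a h(b) + k(b)\<close> with \<open>deg h \<le> d - 1\<close> and \<open>deg k \<le> d\<close>
  (\<open>curve_from_interpolation\<close>), so there is a linear system of \<open>n\<close> equations in only \<open>n - 1\<close> unknowns.

  The existence of a solution comes from moving \<open>B\<close> along the line at infinity. For the direction of
  slope \<open>t\<close> the projection of the \<open>i\<close>-th point is \<open>x\<^sub>i = b\<^sub>i - t a\<^sub>i\<close>. Enlarge the system by one unknown,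
  allowing either \<open>deg k \<le> d + 1\<close> or \<open>deg h \<le> d\<close>, and replace its column functions \<open>1\<close>, \<open>b * b\<^sup>p\<close>, \<open>a b\<^sup>p\<close>
  by \<open>1\<close>, \<open>b x\<^sup>p\<close>, \<open>a x\<^sup>p\<close>, which agree with them at \<open>t = 0\<close>. The determinant of the resulting
  square matrix is a polynomial in \<open>t\<close> of degree at most \<open>d\<^sup>2\<close>. When \<open>t\<close> reaches \<open>\<tau>\<^sub>L\<close>, the points of \<open>L\<close>
  are projected to a single point, and divided differences of the corresponding rows show that the
  determinant is divisible by \<open>(t - \<tau>\<^sub>L)\<close> to the power \<open>(|L| - 1) choose 2\<close>
  (\<open>collinear_points_divide_det\<close>). By hypothesis these factors have total degree larger than \<open>d\<^sup>2\<close>, so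
  the determinant vanishes identically (\<open>det_pencil_matrix_eq_0\<close>). At \<open>t = 0\<close> this gives nonzero
  solutions \<open>(h, k)\<close> and \<open>(h', k')\<close> of the two enlarged systems. If neither has the smaller degrees, then
  \<open>h' k - h k'\<close> has degree exactly \<open>2 d + 1\<close>, although it vanishes at the \<open>2 d + 2\<close> numbers \<open>b\<^sub>i\<close>
  (\<open>bivariate_interpolation_low_degree\<close>).
\<close>

hide_const (open) Module.smult

section \<open>Determinants of polynomial matrices with collinear rows\<close>

definition lagrange_basis :: "('i \<Rightarrow> 'a::field) \<Rightarrow> 'i set \<Rightarrow> 'i \<Rightarrow> 'a \<Rightarrow> 'a" where
  "lagrange_basis a S j x = (\<Prod>l\<in>S - {j}. (x - a l) / (a j - a l))"

text \<open>
  Both sides are polynomials in \<open>x\<close> of degree below \<open>card S\<close> that agree at the \<open>card S\<close> nodes.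
\<close>
lemma lagrange_interpolation:
  fixes a :: "'i \<Rightarrow> 'a::field"
  assumes S: "finite S" and inj: "inj_on a S" and deg: "degree q < card S"
  shows "(\<Sum>j\<in>S. lagrange_basis a S j x * poly q (a j)) = poly q x"
proof -
  define ell where "ell j = (\<Prod>l\<in>S - {j}. smult (inverse (a j - a l)) [:- a l, 1:])" for j
  have ell: "poly (ell j) y = lagrange_basis a S j y" for j y
    unfolding ell_def lagrange_basis_def poly_prod by (rule prod.cong) (simp_all add: divide_inverse algebra_simps)
  define r where "r = (\<Sum>j\<in>S. smult (poly q (a j)) (ell j)) - q"
  have deg_ell: "degree (ell j) \<le> card S - 1" if "j \<in> S" for j
  proof -
    have "degree (ell j) \<le> sum (degree \<circ> (\<lambda>l. smult (inverse (a j - a l)) [:- a l, 1:])) (S - {j})"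
      unfolding ell_def by (rule degree_prod_sum_le) (use S in auto)
    also have "\<dots> \<le> (\<Sum>l\<in>S - {j}. 1)"
      by (rule sum_mono) (simp add: degree_smult_le)
    also have "\<dots> = card S - 1" using that S by simp
    finally show ?thesis .
  qed
  have deg_r: "degree r < card S"
  proof -
    have "degree (\<Sum>j\<in>S. smult (poly q (a j)) (ell j)) \<le> card S - 1"
      by (intro degree_sum_le S order.trans[OF degree_smult_le] deg_ell)
    then show ?thesis unfolding r_def
      by (intro degree_diff_less) (use deg in auto)
  qed
  have basis_delta: "lagrange_basis a S j (a i) = (if i = j then 1 else 0)" if "i \<in> S" "j \<in> S" for i j
  proof (cases "i = j")
    case True
    have "lagrange_basis a S j (a i) = (\<Prod>l\<in>S - {j}. 1)"
      unfolding lagrange_basis_def using True that inj by (intro prod.cong) (auto simp: inj_on_def)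
    with True show ?thesis by simp
  next
    case False
    then show ?thesis using S that by (auto simp: lagrange_basis_def)
  qed
  have "poly r (a i) = 0" if "i \<in> S" for i
    using that S by (simp add: r_def poly_sum ell basis_delta if_distrib cong: if_cong)
  then have roots: "a ` S \<subseteq> {y. poly r y = 0}" by auto
  have "r = 0"
  proof (rule ccontr)
    assume "r \<noteq> 0"
    then have "card (a ` S) \<le> degree r"
      using card_mono[OF poly_roots_finite roots] card_poly_roots_bound[of r] by (auto intro: order.trans)
    with deg_r show False using card_image[OF inj] by simp
  qed
  then have "poly r x = 0" by simp
  then show ?thesis by (simp add: r_def poly_sum ell mult.commute)
qed

lemma smult_sum_right: "smult c (\<Sum>i\<in>I. f i) = (\<Sum>i\<in>I. smult c (f i))"
  by (induction I rule: infinite_finite_induct) (simp_all add: smult_add_right)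

text \<open>
  The orders of vanishing of the successive divided differences of the rows that belong to a set of
  \<open>k\<close> collinear points are \<open>0, 0, 1, 2, \<dots>, k - 2\<close>; this is their total.
\<close>
lemma sum_card_lower_minus_one:
  fixes S :: "nat set"
  assumes "finite S"
  shows "(\<Sum>i\<in>S. card {j\<in>S. j < i} - 1) = (card S - 1) choose 2"
  using assms
proof (induction S rule: finite_linorder_max_induct)
  case empty
  then show ?case by simp
next
  case (insert b A)
  have b: "{j \<in> insert b A. j < b} = A" using insert by auto
  have A: "{j \<in> insert b A. j < i} = {j \<in> A. j < i}" if "i \<in> A" for i
    using insert that by auto
  have bA: "b \<notin> A" using insert by auto
  have "(\<Sum>i\<in>insert b A. card {j\<in>insert b A. j < i} - 1) = (card A - 1) + ((card A - 1) choose 2)"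
    using insert.IH insert.hyps(1) bA by (simp add: b A del: insert_iff cong: sum.cong)
  also have "\<dots> = card A choose 2"
    by (cases "card A") (simp_all add: numeral_2_eq_2)
  finally show ?case using insert bA by simp
qed

lemma prod_dvd_det_of_dvd_rows:
  fixes M :: "'a::comm_ring_1 mat"
  assumes M: "M \<in> carrier_mat n n"
    and rows: "\<And>i j. i < n \<Longrightarrow> j < n \<Longrightarrow> q i dvd M $$ (i, j)"
  shows "(\<Prod>i<n. q i) dvd Determinant.det M"
proof -
  have "(\<Prod>i = 0..<n. q i) dvd (\<Prod>i = 0..<n. M $$ (i, p i))" if "p permutes {0..<n}" for p
    using that by (intro prod_dvd_prod rows) (auto simp: permutes_in_image)
  then show ?thesis
    by (auto simp: det_def'[OF M] lessThan_atLeast0 intro!: dvd_sum dvd_mult)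
qed

lemma degree_det_le_sum_columns:
  fixes M :: "'a::comm_ring_1 poly mat"
  assumes M: "M \<in> carrier_mat n n"
    and cols: "\<And>i j. i < n \<Longrightarrow> j < n \<Longrightarrow> degree (M $$ (i, j)) \<le> e j"
  shows "degree (Determinant.det M) \<le> (\<Sum>j<n. e j)"
  unfolding det_def'[OF M]
proof (rule degree_sum_le)
  show "finite {p. p permutes {0..<n}}" by (simp add: finite_permutations)
  fix p assume "p \<in> {p. p permutes {0..<n}}"
  then have p: "p permutes {0..<n}" by simp
  have "degree (signof p * (\<Prod>i = 0..<n. M $$ (i, p i))) \<le> degree (\<Prod>i = 0..<n. M $$ (i, p i))"
    by (simp add: sign_def)
  also have "\<dots> \<le> (\<Sum>i = 0..<n. degree (M $$ (i, p i)))"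
    using degree_prod_sum_le[of "{0..<n}" "\<lambda>i. M $$ (i, p i)"] by (simp add: o_def)
  also have "\<dots> \<le> (\<Sum>i = 0..<n. e (p i))"
    using p by (intro sum_mono cols) (auto simp: permutes_in_image)
  also have "\<dots> = (\<Sum>i = 0..<n. e i)"
    using sum.permute[OF p, of e] by (simp add: o_def)
  finally show "degree (signof p * (\<Prod>i = 0..<n. M $$ (i, p i))) \<le> (\<Sum>j<n. e j)"
    by (simp add: lessThan_atLeast0)
qed

text \<open>
  Row \<open>i\<close> belongs to the point \<open>(a i, b i)\<close> and column \<open>c\<close> to the function
  \<open>(u c + v c * a + w c * b) * x ^ e c\<close>, where \<open>x = b - t * a\<close> is the projection in the direction of slope
  \<open>t\<close>. The slope \<open>t\<close> is the variable of the entries.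
\<close>
definition pencil_matrix ::
  "nat \<Rightarrow> (nat \<Rightarrow> 'a::field) \<Rightarrow> (nat \<Rightarrow> 'a) \<Rightarrow> (nat \<Rightarrow> 'a) \<Rightarrow> (nat \<Rightarrow> 'a) \<Rightarrow> (nat \<Rightarrow> 'a) \<Rightarrow> (nat \<Rightarrow> nat) \<Rightarrow> 'a poly mat"
  where "pencil_matrix n a b u v w e =
    mat n n (\<lambda>(i, c). smult (u c + v c * a i + w c * b i) ([:b i, - a i:] ^ e c))"

text \<open>
  Put \<open>s = t - \<tau>\<close>. At a point of the line the projection is \<open>\<xi> - s * a\<close>, so every power of \<open>s\<close> brings one
  factor \<open>a\<close>, and the affine factor in front adds at most one more: the coefficient of \<open>s ^ r\<close> in an entry
  of the row is a polynomial in \<open>a\<close> of degree at most \<open>r + 1\<close>. Subtracting from a row its Lagrange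
  interpolation from the \<open>m\<close> earlier rows of the line kills the polynomials of degree below \<open>m\<close>, hence the
  coefficients with \<open>r + 1 < m\<close>, and makes the row divisible by \<open>s ^ (m - 1)\<close>. These row operations are
  unitriangular.
\<close>
lemma collinear_points_divide_det:
  fixes a b :: "nat \<Rightarrow> 'a::field"
  assumes S: "S \<subseteq> {..<n}" and inj: "inj_on a S"
    and line: "\<And>i. i \<in> S \<Longrightarrow> b i = \<xi> + \<tau> * a i"
  shows "[:- \<tau>, 1:] ^ ((card S - 1) choose 2) dvd Determinant.det (pencil_matrix n a b u v w e)"
proof -
  define M where "M = pencil_matrix n a b u v w e"
  define s where "s = [:- \<tau>, 1:]"
  define R where "R i = {j\<in>S. j < i}" for i
  \<comment> \<open>Row operations: a row of the line minus its interpolation from the earlier rows of the line.\<close>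
  define T where "T = mat n n (\<lambda>(i, j). if i = j then 1
     else if i \<in> S \<and> j \<in> R i then [:- lagrange_basis a (R i) j (a i):] else 0)"
  have fin: "finite S" using S finite_subset by blast
  then have finR: "finite (R i)" for i by (simp add: R_def)
  have M: "M \<in> carrier_mat n n" and T: "T \<in> carrier_mat n n"
    by (simp_all add: M_def T_def pencil_matrix_def)
  have detT: "Determinant.det T = 1"
  proof -
    have "Determinant.det T = prod_list (diag_mat T)"
      by (rule det_lower_triangular[OF _ T]) (auto simp: T_def R_def)
    also have "\<dots> = 1"
      unfolding prod_list_diag_prod by (rule prod.neutral) (auto simp: T_def)
    finally show ?thesis .
  qed
  \<comment> \<open>Truncated subtraction: the first row of the line is left as it is and gains no factor.\<close>
  define f where "f i = (if i \<in> S then card (R i) - 1 else 0)" for i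
  have rows: "s ^ f i dvd (T * M) $$ (i, c)" if i: "i < n" and c: "c < n" for i c
  proof (cases "i \<in> S")
    case False
    then show ?thesis by (simp add: f_def)
  next
    case True
    define A where "A = u c + w c * \<xi>"
    define B where "B = v c + w c * \<tau>"
    define p where "p = e c"
    define q where "q r = smult (of_nat (p choose r) * \<xi> ^ (p - r)) ([:A, B:] * [:0, -1:] ^ r)" for r
    have deg_q: "degree (q r) \<le> Suc r" for r
    proof -
      have "degree (q r) \<le> degree ([:A, B:] * [:0, -1:] ^ r)"
        unfolding q_def by (rule degree_smult_le)
      also have "\<dots> \<le> degree [:A, B:] + degree ([:0, -1 :: 'a:] ^ r)"
        by (rule degree_mult_le)
      also have "\<dots> \<le> 1 + 1 * r"
        by (intro add_mono order.trans[OF degree_power_le]) auto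
      finally show ?thesis by simp
    qed
    have entry: "M $$ (j, c) = (\<Sum>r\<le>p. smult (poly (q r) (a j)) (s ^ r))" if j: "j \<in> S" for j
    proof -
      have jn: "j < n" using S j by auto
      have "[:b j, - a j:] = smult (- a j) s + [:\<xi>:]"
        by (simp add: s_def line[OF j] mult.commute)
      then have "[:b j, - a j:] ^ p = (\<Sum>r\<le>p. of_nat (p choose r) * smult (- a j) s ^ r * [:\<xi>:] ^ (p - r))"
        by (simp only: binomial_ring)
      also have "\<dots> = (\<Sum>r\<le>p. smult (of_nat (p choose r) * \<xi> ^ (p - r) * (- a j) ^ r) (s ^ r))"
        by (intro sum.cong refl)
          (simp add: smult_power poly_const_pow of_nat_poly mult_ac
            del: smult_minus_left)
      finally have pw: "[:b j, - a j:] ^ p = (\<Sum>r\<le>p. smult (of_nat (p choose r) * \<xi> ^ (p - r) * (- a j) ^ r) (s ^ r))" .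
      have "u c + v c * a j + w c * b j = A + a j * B"
        by (simp add: A_def B_def line[OF j] algebra_simps)
      then have "M $$ (j, c) = smult (A + a j * B) ([:b j, - a j:] ^ p)"
        using jn c by (simp add: M_def pencil_matrix_def p_def)
      also have "\<dots> = (\<Sum>r\<le>p. smult (poly (q r) (a j)) (s ^ r))"
        unfolding pw smult_sum_right by (intro sum.cong refl) (simp add: q_def algebra_simps)
      finally show ?thesis .
    qed
    have "(T * M) $$ (i, c) = (\<Sum>j\<in>{0..<n}. T $$ (i, j) * M $$ (j, c))"
      using i c M T by (simp add: scalar_prod_def)
    also have "\<dots> = (\<Sum>j\<in>insert i (R i). T $$ (i, j) * M $$ (j, c))"
      by (rule sum.mono_neutral_right) (use i S True in \<open>auto simp: T_def R_def\<close>)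
    also have "\<dots> = M $$ (i, c) + (\<Sum>j\<in>R i. T $$ (i, j) * M $$ (j, c))"
      using finR by (simp add: R_def T_def i)
    also have "(\<Sum>j\<in>R i. T $$ (i, j) * M $$ (j, c)) = (\<Sum>j\<in>R i. smult (- lagrange_basis a (R i) j (a i)) (M $$ (j, c)))"
      by (rule sum.cong) (use i S True in \<open>auto simp: T_def R_def\<close>)
    also have "\<dots> = (\<Sum>j\<in>R i. \<Sum>r\<le>p. smult (- lagrange_basis a (R i) j (a i) * poly (q r) (a j)) (s ^ r))"
      by (rule sum.cong) (auto simp: R_def entry smult_sum_right)
    also have "\<dots> = (\<Sum>r\<le>p. smult (- (\<Sum>j\<in>R i. lagrange_basis a (R i) j (a i) * poly (q r) (a j))) (s ^ r))"
      by (subst sum.swap) (simp add: smult_sum sum_negf[symmetric])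
    finally have row: "(T * M) $$ (i, c) =
        (\<Sum>r\<le>p. smult (poly (q r) (a i) - (\<Sum>j\<in>R i. lagrange_basis a (R i) j (a i) * poly (q r) (a j))) (s ^ r))"
      by (simp add: entry[OF True] sum.distrib[symmetric] smult_diff_left sum_subtractf)
    show ?thesis unfolding row
    proof (rule dvd_sum)
      fix r assume "r \<in> {..p}"
      show "s ^ f i dvd smult (poly (q r) (a i) - (\<Sum>j\<in>R i. lagrange_basis a (R i) j (a i) * poly (q r) (a j))) (s ^ r)"
      proof (cases "Suc r < card (R i)")
        case True
        have "inj_on a (R i)" using inj by (rule inj_on_subset) (auto simp: R_def)
        from lagrange_interpolation[OF finR this, of "q r" "a i"]
        show ?thesis using True deg_q[of r] by simp
      next
        case False
        then have "f i \<le> r" by (auto simp: f_def)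
        then show ?thesis by (intro dvd_smult le_imp_power_dvd)
      qed
    qed
  qed
  have "(\<Prod>i<n. s ^ f i) dvd Determinant.det (T * M)"
    by (rule prod_dvd_det_of_dvd_rows[OF mult_carrier_mat[OF T M] rows])
  moreover have "(\<Prod>i<n. s ^ f i) = s ^ ((card S - 1) choose 2)"
  proof -
    have "(\<Sum>i<n. f i) = (\<Sum>i\<in>S. card (R i) - 1)"
      using sum.mono_neutral_right[OF _ S, of f] by (simp add: f_def)
    also have "\<dots> = (card S - 1) choose 2"
      unfolding R_def by (rule sum_card_lower_minus_one[OF fin])
    finally show ?thesis by (simp only: power_sum[symmetric])
  qed
  ultimately show ?thesis
    using det_mult[OF T M] detT by (simp add: M_def s_def)
qed

text \<open>
  Distinct lines have distinct slopes, so the multiplicities at these slopes add up. A nonzero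
  determinant would have more zeros than its degree allows.
\<close>
lemma det_pencil_matrix_eq_0:
  fixes a b :: "nat \<Rightarrow> 'a::field"
  assumes b: "inj_on b {..<n}"
    and fin: "finite \<L>" and \<tau>: "inj_on \<tau> \<L>"
    and S: "\<And>L. L \<in> \<L> \<Longrightarrow> S L \<subseteq> {..<n}"
    and line: "\<And>L i. L \<in> \<L> \<Longrightarrow> i \<in> S L \<Longrightarrow> b i = \<xi> L + \<tau> L * a i"
    and many: "(\<Sum>c<n. e c) < (\<Sum>L\<in>\<L>. (card (S L) - 1) choose 2)"
  shows "Determinant.det (pencil_matrix n a b u v w e) = 0" (is "?D = 0")
proof (rule ccontr)
  assume nz: "?D \<noteq> 0"
  have inj: "inj_on a (S L)" if "L \<in> \<L>" for L
  proof (rule inj_onI)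
    fix i j assume ij: "i \<in> S L" "j \<in> S L" "a i = a j"
    then have "b i = b j" by (simp add: line[OF that])
    with b S[OF that] ij show "i = j" by (auto dest: inj_onD)
  qed
  have "(card (S L) - 1) choose 2 \<le> order (\<tau> L) ?D" if "L \<in> \<L>" for L
  proof -
    have "[:- \<tau> L, 1:] ^ ((card (S L) - 1) choose 2) dvd ?D"
      by (rule collinear_points_divide_det[OF S[OF that] inj[OF that] line[OF that]])
    with nz show ?thesis by (simp only: order_divides simp_thms)
  qed
  then have "(\<Sum>L\<in>\<L>. (card (S L) - 1) choose 2) \<le> (\<Sum>L\<in>\<L>. order (\<tau> L) ?D)"
    by (rule sum_mono)
  also have "\<dots> = (\<Sum>x\<in>\<tau> ` \<L>. order x ?D)"
    using \<tau> by (simp add: sum.reindex)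
  also have "\<dots> = (\<Sum>x\<in>\<tau> ` \<L> \<inter> {x. poly ?D x = 0}. order x ?D)"
    using fin nz by (intro sum.mono_neutral_right) (auto simp: order_root)
  also have "\<dots> \<le> (\<Sum>x | poly ?D x = 0. order x ?D)"
    using nz by (intro sum_mono2) (auto simp: poly_roots_finite)
  also have "\<dots> \<le> degree ?D" by (rule sum_order_le_degree[OF nz])
  also have "\<dots> \<le> (\<Sum>c<n. e c)"
  proof (rule degree_det_le_sum_columns)
    show "pencil_matrix n a b u v w e \<in> carrier_mat n n" by (simp add: pencil_matrix_def)
    fix i j assume ij: "i < n" "j < n"
    have "degree ([:b i, - a i:] ^ e j) \<le> degree [:b i, - a i:] * e j"
      by (rule degree_power_le)
    also have "\<dots> \<le> 1 * e j" by (rule mult_right_mono) auto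
    finally have "degree ([:b i, - a i:] ^ e j) \<le> e j" by simp
    with ij show "degree (pencil_matrix n a b u v w e $$ (i, j)) \<le> e j"
      by (simp add: pencil_matrix_def order.trans[OF degree_smult_le])
  qed
  finally show False using many by simp
qed

section \<open>Interpolation on an affine point set with many collinear points\<close>

lemma sum_lessThan_add:
  "(\<Sum>c<m + l. g c) = (\<Sum>c<m. g c) + (\<Sum>c<l. g (c + m))" for g :: "nat \<Rightarrow> 'b::comm_monoid_add"
  by (induction l) (simp_all add: ac_simps)

text \<open>
  The columns are \<open>1\<close>, \<open>b * x ^ p\<close> for \<open>p < r\<close> and \<open>a * x ^ p\<close> for \<open>p \<le> 2 * d - r\<close>. For both values of \<open>r\<close>
  their degrees add up to \<open>d\<^sup>2\<close>. Using \<open>b * x ^ p\<close> in place of \<open>x ^ (p + 1)\<close>, which is the same function at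
  \<open>t = 0\<close>, is what keeps this sum so small.
\<close>
lemma bivariate_interpolation:
  fixes a b :: "nat \<Rightarrow> 'a::field"
  assumes d: "0 < d" and n: "n = 2 * d + 2" and r: "r = d \<or> r = d + 1"
    and b: "inj_on b {..<n}"
    and fin: "finite \<L>" and \<tau>: "inj_on \<tau> \<L>"
    and S: "\<And>L. L \<in> \<L> \<Longrightarrow> S L \<subseteq> {..<n}"
    and line: "\<And>L i. L \<in> \<L> \<Longrightarrow> i \<in> S L \<Longrightarrow> b i = \<xi> L + \<tau> L * a i"
    and many: "d\<^sup>2 < (\<Sum>L\<in>\<L>. (card (S L) - 1) choose 2)"
  obtains h k :: "'a poly" where "h \<noteq> 0 \<or> k \<noteq> 0" "degree h \<le> 2 * d - r" "degree k \<le> r"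
    "\<And>i. i < n \<Longrightarrow> a i * poly h (b i) + poly k (b i) = 0"
proof -
  \<comment> \<open>The columns up to \<open>r\<close> are \<open>1, b, b x, \<dots>\<close>, the remaining ones are \<open>a, a x, \<dots>\<close>.\<close>
  define u v w :: "nat \<Rightarrow> 'a" where "u c = (if c = 0 then 1 else 0)"
    and "v c = (if r < c then 1 else 0)" and "w c = (if 0 < c \<and> c \<le> r then 1 else 0)" for c
  define e where "e c = (if c \<le> r then c - 1 else c - (r + 1))" for c
  define M where "M = pencil_matrix n a b u v w e"
  have M: "M \<in> carrier_mat n n" by (simp add: M_def pencil_matrix_def)
  have "r + 1 + (2 * d + 1 - r) = n" using n r by auto
  note split_sum = sum_lessThan_add[of _ "r + 1" "2 * d + 1 - r", unfolded this]
  have gauss: "2 * (\<Sum>c<m. c) = m * (m - 1)" for m :: nat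
    by (induction m) (auto simp: algebra_simps)
  have "(\<Sum>c<r + 1. e c) = (\<Sum>c<r. c)"
    using sum.lessThan_Suc_shift[of e r] by (simp add: e_def del: sum.lessThan_Suc)
  moreover have "(\<Sum>c<2 * d + 1 - r. e (c + (r + 1))) = (\<Sum>c<2 * d + 1 - r. c)"
    by (rule sum.cong) (simp_all add: e_def)
  ultimately have "2 * (\<Sum>c<n. e c) = r * (r - 1) + (2 * d + 1 - r) * (2 * d - r)"
    using gauss[of r] gauss[of "2 * d + 1 - r"] by (simp add: split_sum)
  also have "\<dots> = 2 * d\<^sup>2"
  proof -
    obtain d' where d': "d = Suc d'" using d by (cases d) auto
    from r show ?thesis
    proof
      assume "r = d"
      then show ?thesis by (simp add: d' power2_eq_square algebra_simps)
    next
      assume "r = d + 1"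
      then show ?thesis by (simp add: d' power2_eq_square algebra_simps)
    qed
  qed
  finally have "(\<Sum>c<n. e c) < (\<Sum>L\<in>\<L>. (card (S L) - 1) choose 2)"
    using many by simp
  from det_pencil_matrix_eq_0[OF b fin \<tau> S line this, of u v w]
  have "Determinant.det M = 0" by (simp add: M_def)
  \<comment> \<open>Specialise to \<open>t = 0\<close>, where \<open>x = b\<close>.\<close>
  interpret ev: comm_ring_hom "\<lambda>p :: 'a poly. poly p 0"
    by unfold_locales auto
  define M0 where "M0 = map_mat (\<lambda>p. poly p 0) M"
  have M0: "M0 \<in> carrier_mat n n" using M by (simp add: M0_def)
  have "Determinant.det M0 = 0"
    using \<open>Determinant.det M = 0\<close> by (simp add: M0_def)
  then obtain x where x: "x \<in> carrier_vec n" "x \<noteq> 0\<^sub>v n" "M0 *\<^sub>v x = 0\<^sub>v n"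
    using det_0_iff_vec_prod_zero_field[OF M0] by auto
  define k where "k = (\<Sum>c<r + 1. monom (vec_index x c) c)"
  define h where "h = (\<Sum>c<2 * d + 1 - r. monom (vec_index x (c + (r + 1))) c)"
  have coeff_k: "poly.coeff k c = (if c < r + 1 then vec_index x c else 0)" for c
    by (simp add: k_def coeff_sum coeff_monom)
  have coeff_h: "poly.coeff h c = (if c < 2 * d + 1 - r then vec_index x (c + (r + 1)) else 0)" for c
    by (simp add: h_def coeff_sum coeff_monom)
  show thesis
  proof (rule that)
    show "h \<noteq> 0 \<or> k \<noteq> 0"
    proof (rule ccontr)
      assume "\<not> (h \<noteq> 0 \<or> k \<noteq> 0)"
      then have hk: "poly.coeff h c = 0" "poly.coeff k c = 0" for c by simp_all
      have "vec_index x c = 0" if "c < n" for c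
      proof (cases "c < r + 1")
        case True
        with hk(2)[of c] show ?thesis by (simp add: coeff_k)
      next
        case False
        with hk(1)[of "c - (r + 1)"] that n show ?thesis
          by (auto simp: coeff_h split: if_splits)
      qed
      then have "x = 0\<^sub>v n" using x(1) by (intro eq_vecI) auto
      with x(2) show False by simp
    qed
    show "degree h \<le> 2 * d - r" by (rule degree_le) (use n r in \<open>auto simp: coeff_h\<close>)
    show "degree k \<le> r" by (rule degree_le) (auto simp: coeff_k)
    fix i assume i: "i < n"
    have "0 = vec_index (M0 *\<^sub>v x) i" using x i by simp
    also have "\<dots> = (\<Sum>c<n. (u c + v c * a i + w c * b i) * b i ^ e c * vec_index x c)"
    proof -
      have "M0 $$ (i, c) = (u c + v c * a i + w c * b i) * b i ^ e c" if "c < n" for c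
        using i that by (simp add: M0_def M_def pencil_matrix_def)
      then have "(\<Sum>c<n. M0 $$ (i, c) * vec_index x c) =
          (\<Sum>c<n. (u c + v c * a i + w c * b i) * b i ^ e c * vec_index x c)"
        by simp
      moreover have "vec_index (M0 *\<^sub>v x) i = (\<Sum>c<n. M0 $$ (i, c) * vec_index x c)"
        using i x(1) M0 by (simp add: scalar_prod_def lessThan_atLeast0)
      ultimately show ?thesis by simp
    qed
    also have "\<dots> = (\<Sum>c<r + 1. vec_index x c * b i ^ c) +
        (\<Sum>c<2 * d + 1 - r. a i * (vec_index x (c + (r + 1)) * b i ^ c))"
    proof -
      have low: "(u c + v c * a i + w c * b i) * b i ^ e c = b i ^ c" if "c < r + 1" for c
        using that by (cases c) (auto simp: u_def v_def w_def e_def)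
      have high: "(u (c + (r + 1)) + v (c + (r + 1)) * a i + w (c + (r + 1)) * b i) * b i ^ e (c + (r + 1))
          = a i * b i ^ c" for c
        by (simp add: u_def v_def w_def e_def)
      show ?thesis
        unfolding split_sum high using low
        by (intro arg_cong2[where f = "(+)"] sum.cong) (simp_all add: mult_ac)
    qed
    also have "\<dots> = a i * poly h (b i) + poly k (b i)"
      by (simp add: h_def k_def poly_sum poly_monom sum_distrib_left del: sum.lessThan_Suc)
    finally show "a i * poly h (b i) + poly k (b i) = 0" by simp
  qed
qed

text \<open>
  One enlarged system exceeds the wanted bound on \<open>deg k\<close> by one, the other the bound on \<open>deg h\<close>. If both
  solutions attain the larger degree, eliminating \<open>a\<close> between them gives a polynomial of degree
  \<open>2 * d + 1\<close> with \<open>2 * d + 2\<close> roots.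
\<close>
lemma bivariate_interpolation_low_degree:
  fixes a b :: "nat \<Rightarrow> 'a::field"
  assumes d: "0 < d" and n: "n = 2 * d + 2"
    and b: "inj_on b {..<n}"
    and fin: "finite \<L>" and \<tau>: "inj_on \<tau> \<L>"
    and S: "\<And>L. L \<in> \<L> \<Longrightarrow> S L \<subseteq> {..<n}"
    and line: "\<And>L i. L \<in> \<L> \<Longrightarrow> i \<in> S L \<Longrightarrow> b i = \<xi> L + \<tau> L * a i"
    and many: "d\<^sup>2 < (\<Sum>L\<in>\<L>. (card (S L) - 1) choose 2)"
  obtains h k :: "'a poly" where "h \<noteq> 0 \<or> k \<noteq> 0" "degree h \<le> d - 1" "degree k \<le> d"
    "\<And>i. i < n \<Longrightarrow> a i * poly h (b i) + poly k (b i) = 0"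
proof -
  note interpolation = bivariate_interpolation[OF d n _ b fin \<tau> S line many]
  obtain h k where hk: "h \<noteq> 0 \<or> k \<noteq> 0" "degree h \<le> d - 1" "degree k \<le> d + 1"
    and vanish: "\<And>i. i < n \<Longrightarrow> a i * poly h (b i) + poly k (b i) = 0"
    by (rule interpolation[of "d + 1"]) (use d in auto)
  obtain h' k' where hk': "h' \<noteq> 0 \<or> k' \<noteq> 0" "degree h' \<le> d" "degree k' \<le> d"
    and vanish': "\<And>i. i < n \<Longrightarrow> a i * poly h' (b i) + poly k' (b i) = 0"
    by (rule interpolation[of d]) auto
  consider "degree k \<le> d" | "degree h' \<le> d - 1" | "degree k = d + 1" "degree h' = d"
    using hk hk' by linarith
  then show thesis
  proof cases
    case 1
    with hk vanish that show ?thesis by blast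
  next
    case 2
    with hk' vanish' that show ?thesis by blast
  next
    case 3
    \<comment> \<open>Elimination of \<open>a\<close>; the first product has degree \<open>2 d + 1\<close>, the second at most \<open>2 d - 1\<close>.\<close>
    define q where "q = h' * k - h * k'"
    have "h' \<noteq> 0" "k \<noteq> 0" using 3 d by auto
    then have "degree (h' * k) = 2 * d + 1" using 3 by (simp add: degree_mult_eq)
    moreover have "degree (h * k') < 2 * d + 1"
      using degree_mult_le[of h k'] hk hk' by simp
    ultimately have deg: "degree q = 2 * d + 1" unfolding q_def
      using degree_add_eq_left[of "- (h * k')" "h' * k"] by simp
    have "poly q (b i) = 0" if "i < n" for i
    proof -
      have k: "poly k (b i) = - (a i * poly h (b i))"
        using vanish[OF that] by (simp only: add_eq_0_iff)
      have k': "poly k' (b i) = - (a i * poly h' (b i))"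
        using vanish'[OF that] by (simp only: add_eq_0_iff)
      show ?thesis by (simp add: q_def k k')
    qed
    then have roots: "b ` {..<n} \<subseteq> {x. poly q x = 0}" by auto
    have "q \<noteq> 0" using deg by auto
    from card_mono[OF poly_roots_finite[OF this] roots] card_poly_roots_bound[OF this]
    have "card (b ` {..<n}) \<le> degree q" by simp
    then show ?thesis using deg n card_image[OF b] by simp
  qed
qed

section \<open>Ternary forms: evaluation, derivatives and order of vanishing\<close>

lemma tpoly_induct [case_names zero single_add]:
  fixes F :: "'a::field tpoly"
  assumes "P 0" and add: "\<And>e c F. P F \<Longrightarrow> P (Poly_Mapping.single e c + F)"
  shows "P F"
proof (induction F rule: Poly_Mapping.update_induct)
  case const
  show ?case by (rule assms)
next
  case (update f e c)
  have "Poly_Mapping.update e c f = Poly_Mapping.single e c + f"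
    using update(1)
    by (intro poly_mapping_eqI) (auto simp: lookup_update lookup_add lookup_single in_keys_iff when_def)
  then show ?case using add[OF update(3)] by simp
qed

lemma tp_eval_superset:
  assumes "finite A" "Poly_Mapping.keys F \<subseteq> A"
  shows "tp_eval F v = (\<Sum>e\<in>A. Poly_Mapping.lookup F e * (\<Prod>i\<in>UNIV. (v $ i) ^ Poly_Mapping.lookup e i))"
  unfolding tp_eval_def
  by (rule sum.mono_neutral_left) (use assms in \<open>auto simp: in_keys_iff\<close>)

lemma tp_eval_zero [simp]: "tp_eval 0 v = 0"
  by (simp add: tp_eval_def)

lemma tp_eval_add [simp]: "tp_eval (F + G) v = tp_eval F v + tp_eval G v"
proof -
  define A where "A = Poly_Mapping.keys F \<union> Poly_Mapping.keys G"
  have "finite A" "Poly_Mapping.keys F \<subseteq> A" "Poly_Mapping.keys G \<subseteq> A" "Poly_Mapping.keys (F + G) \<subseteq> A"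
    using Poly_Mapping.keys_add[of F G] by (auto simp: A_def)
  then show ?thesis
    by (simp add: tp_eval_superset[of A] lookup_add distrib_right sum.distrib)
qed

lemma tp_eval_single:
  "tp_eval (Poly_Mapping.single e c) v = c * (\<Prod>i\<in>UNIV. (v $ i) ^ Poly_Mapping.lookup e i)"
  by (simp add: tp_eval_superset[of "{e}"])

lemma tp_eval_mult [simp]: "tp_eval (F * G) v = tp_eval F v * tp_eval G v"
proof (induction F rule: tpoly_induct)
  case zero
  show ?case by simp
next
  case (single_add e c F)
  have "tp_eval (Poly_Mapping.single e c * G) v = tp_eval (Poly_Mapping.single e c) v * tp_eval G v"
  proof (induction G rule: tpoly_induct)
    case zero
    show ?case by simp
  next
    case (single_add f g G)
    then show ?case
      by (simp add: distrib_left mult_single tp_eval_single lookup_add power_add prod.distrib mult_ac)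
  qed
  with single_add show ?case by (simp add: distrib_right)
qed

lemma tp_eval_one [simp]: "tp_eval 1 v = 1"
  using tp_eval_single[of 0 1 v] by simp

lemma tp_eval_power [simp]: "tp_eval (F ^ k) v = tp_eval F v ^ k"
  by (induction k) simp_all

lemma tp_eval_sum [simp]: "tp_eval (\<Sum>x\<in>A. f x) v = (\<Sum>x\<in>A. tp_eval (f x) v)"
  by (induction A rule: infinite_finite_induct) simp_all

lemma tp_eval_prod [simp]: "tp_eval (\<Prod>x\<in>A. f x) v = (\<Prod>x\<in>A. tp_eval (f x) v)"
  by (induction A rule: infinite_finite_induct) simp_all

lemma tp_deriv_superset:
  assumes "finite A" "Poly_Mapping.keys F \<subseteq> A"
  shows "tp_deriv i F = (\<Sum>e\<in>A. Poly_Mapping.single (e - Poly_Mapping.single i 1)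
    (of_nat (Poly_Mapping.lookup e i) * Poly_Mapping.lookup F e))"
  unfolding tp_deriv_def
  by (rule sum.mono_neutral_left) (use assms in \<open>auto simp: in_keys_iff\<close>)

lemma tp_deriv_zero [simp]: "tp_deriv i 0 = 0"
  by (simp add: tp_deriv_def)

lemma tp_deriv_add [simp]: "tp_deriv i (F + G) = tp_deriv i F + tp_deriv i G"
proof -
  define A where "A = Poly_Mapping.keys F \<union> Poly_Mapping.keys G"
  have "finite A" "Poly_Mapping.keys F \<subseteq> A" "Poly_Mapping.keys G \<subseteq> A" "Poly_Mapping.keys (F + G) \<subseteq> A"
    using Poly_Mapping.keys_add[of F G] by (auto simp: A_def)
  then show ?thesis
    by (simp add: tp_deriv_superset[of A] lookup_add distrib_left single_add sum.distrib)
qed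

lemma tp_deriv_single:
  "tp_deriv i (Poly_Mapping.single e c) =
    Poly_Mapping.single (e - Poly_Mapping.single i 1) (of_nat (Poly_Mapping.lookup e i) * c)"
  by (simp add: tp_deriv_superset[of "{e}"])

text \<open>
  If \<open>e\<close> does not contain the variable \<open>i\<close>, the truncated subtraction can make the two exponents differ,
  but then the coefficient is zero.
\<close>
lemma single_lower_exponent:
  fixes e f :: "3 \<Rightarrow>\<^sub>0 nat" and c :: "'a::field"
  shows "Poly_Mapping.single (e - Poly_Mapping.single i 1 + f) (of_nat (Poly_Mapping.lookup e i) * c) =
    Poly_Mapping.single (e + f - Poly_Mapping.single i 1) (of_nat (Poly_Mapping.lookup e i) * c)"
proof (cases "Poly_Mapping.lookup e i = 0")
  case False
  have "e - Poly_Mapping.single i 1 + f = e + f - Poly_Mapping.single i 1"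
    by (rule poly_mapping_eqI) (use False in \<open>auto simp: lookup_add lookup_minus lookup_single when_def\<close>)
  then show ?thesis by simp
qed simp

lemma tp_deriv_mult: "tp_deriv i (F * G) = tp_deriv i F * G + F * tp_deriv i G"
proof (induction F rule: tpoly_induct)
  case zero
  show ?case by simp
next
  case (single_add e c F)
  have "tp_deriv i (Poly_Mapping.single e c * G) =
    tp_deriv i (Poly_Mapping.single e c) * G + Poly_Mapping.single e c * tp_deriv i G"
  proof (induction G rule: tpoly_induct)
    case zero
    show ?case by simp
  next
    case (single_add f g G)
    have "tp_deriv i (Poly_Mapping.single e c * Poly_Mapping.single f g) =
        Poly_Mapping.single (e + f - Poly_Mapping.single i 1) (of_nat (Poly_Mapping.lookup e i) * (c * g)) +
        Poly_Mapping.single (f + e - Poly_Mapping.single i 1) (of_nat (Poly_Mapping.lookup f i) * (c * g))"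
      by (simp add: mult_single tp_deriv_single lookup_add distrib_right add.commute flip: Poly_Mapping.single_add)
    also have "\<dots> = tp_deriv i (Poly_Mapping.single e c) * Poly_Mapping.single f g +
        Poly_Mapping.single e c * tp_deriv i (Poly_Mapping.single f g)"
      unfolding single_lower_exponent[symmetric]
      by (simp add: mult_single tp_deriv_single mult_ac add.commute)
    finally show ?case using single_add by (simp add: algebra_simps)
  qed
  with single_add show ?case by (simp add: algebra_simps)
qed

text \<open>
  The order of vanishing at a vector, unfolded one derivative at a time; this recursive form is the one
  that suits the induction in the product rule below.
\<close>
fun mult_at_least :: "'a::field ^ 3 \<Rightarrow> nat \<Rightarrow> 'a tpoly \<Rightarrow> bool" where
  "mult_at_least v 0 F \<longleftrightarrow> True"
| "mult_at_least v (Suc m) F \<longleftrightarrow> tp_eval F v = 0 \<and> (\<forall>i. mult_at_least v m (tp_deriv i F))"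

lemma mult_at_least_fold:
  "mult_at_least v m F \<Longrightarrow> length is < m \<Longrightarrow> tp_eval (fold tp_deriv is F) v = 0"
proof (induction "is" arbitrary: m F)
  case Nil
  then show ?case by (cases m) auto
next
  case (Cons i "is")
  then show ?case by (cases m) auto
qed

lemma vanishes_to_orderI:
  assumes "\<And>v. v \<in> B \<Longrightarrow> mult_at_least v m F"
  shows "vanishes_to_order m F B"
  using mult_at_least_fold[OF assms] by (auto simp: vanishes_to_order_def vanishes_at_def)

lemma mult_at_least_mono: "mult_at_least v m F \<Longrightarrow> l \<le> m \<Longrightarrow> mult_at_least v l F"
proof (induction m arbitrary: l F)
  case (Suc m)
  then show ?case by (cases l) auto
qed simp

lemma mult_at_least_zero: "mult_at_least v m 0"
  by (induction m) simp_all

lemma mult_at_least_add: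
  "mult_at_least v m F \<Longrightarrow> mult_at_least v m G \<Longrightarrow> mult_at_least v m (F + G)"
  by (induction m arbitrary: F G) simp_all

lemma mult_at_least_sum:
  "(\<And>x. x \<in> A \<Longrightarrow> mult_at_least v m (f x)) \<Longrightarrow> mult_at_least v m (\<Sum>x\<in>A. f x)"
  by (induction A rule: infinite_finite_induct) (simp_all add: mult_at_least_zero mult_at_least_add)

text \<open>
  By the Leibniz rule a derivative of the product is a sum of two products whose orders add up
  to at least \<open>k + l - 1\<close>.
\<close>
lemma mult_at_least_mult:
  "mult_at_least v k F \<Longrightarrow> mult_at_least v l G \<Longrightarrow> mult_at_least v (k + l) (F * G)"
proof (induction "k + l" arbitrary: k l F G)
  case 0
  then show ?case by simp
next
  case (Suc n)
  have left: "mult_at_least v n (tp_deriv i F * G)" for i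
  proof (cases k)
    case 0
    with Suc.prems Suc.hyps(2) have "mult_at_least v n G" by (auto intro: mult_at_least_mono)
    with Suc.hyps(1)[of 0 n] show ?thesis by simp
  next
    case (Suc k')
    with Suc.prems Suc.hyps(2) have "mult_at_least v k' (tp_deriv i F)" "n = k' + l" by auto
    with Suc.hyps(1) Suc.prems show ?thesis by blast
  qed
  have right: "mult_at_least v n (F * tp_deriv i G)" for i
  proof (cases l)
    case 0
    with Suc.prems Suc.hyps(2) have "mult_at_least v n F" by (auto intro: mult_at_least_mono)
    with Suc.hyps(1)[of n 0] show ?thesis by simp
  next
    case (Suc l')
    with Suc.prems Suc.hyps(2) have "mult_at_least v l' (tp_deriv i G)" "n = k + l'" by auto
    with Suc.hyps(1) Suc.prems show ?thesis by blast
  qed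
  have "tp_eval (F * G) v = 0"
    using Suc.prems Suc.hyps(2) by (cases k; cases l) auto
  then have "mult_at_least v (Suc n) (F * G)"
    using left right by (auto simp: tp_deriv_mult intro: mult_at_least_add)
  then show ?case using Suc.hyps(2) by simp
qed

lemma mult_at_least_power: "tp_eval F v = 0 \<Longrightarrow> mult_at_least v k (F ^ k)"
proof (induction k)
  case (Suc k)
  then have "mult_at_least v 1 F" "mult_at_least v k (F ^ k)" by simp_all
  from mult_at_least_mult[OF this] show ?case by simp
qed simp

lemma forms_zero: "0 \<in> forms d"
  by (simp add: forms_def)

lemma forms_add: "F \<in> forms d \<Longrightarrow> G \<in> forms d \<Longrightarrow> F + G \<in> forms d"
  using Poly_Mapping.keys_add[of F G] by (auto simp: forms_def)

lemma forms_sum: "(\<And>x. x \<in> A \<Longrightarrow> f x \<in> forms d) \<Longrightarrow> (\<Sum>x\<in>A. f x) \<in> forms d"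
  by (induction A rule: infinite_finite_induct) (simp_all add: forms_zero forms_add)

lemma forms_mult: "F \<in> forms d \<Longrightarrow> G \<in> forms e \<Longrightarrow> F * G \<in> forms (d + e)"
  using keys_mult[of F G] by (fastforce simp: forms_def lookup_add sum.distrib)

lemma forms_const: "Poly_Mapping.single 0 c \<in> forms 0"
  by (auto simp: forms_def)

lemma forms_one: "1 \<in> forms 0"
  using forms_const[of 1] by simp

lemma forms_power: "F \<in> forms 1 \<Longrightarrow> F ^ k \<in> forms k"
proof (induction k)
  case (Suc k)
  then show ?case using forms_mult[of F 1 "F ^ k" k] by simp
qed (simp add: forms_one)

definition linear_form :: "'a::field ^ 3 \<Rightarrow> 'a tpoly" where
  "linear_form c = (\<Sum>i\<in>UNIV. Poly_Mapping.single (Poly_Mapping.single i 1) (c $ i))"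

lemma linear_form_in_forms: "linear_form c \<in> forms 1"
  unfolding linear_form_def
  by (rule forms_sum) (auto simp: forms_def lookup_single when_def)

lemma tp_eval_linear_form: "tp_eval (linear_form c) v = (\<Sum>i\<in>UNIV. c $ i * v $ i)"
proof -
  have "(\<Prod>j\<in>UNIV. (v $ j) ^ (1 when i = j)) = v $ i" for i
    by (subst prod.remove[of _ i]) (auto simp: when_def intro!: prod.neutral)
  then show ?thesis
    by (simp add: linear_form_def tp_eval_single lookup_single)
qed

text \<open>
  The binary form \<open>Y ^ m * q (X / Y)\<close>.
\<close>
definition homogenize :: "nat \<Rightarrow> 'a::field poly \<Rightarrow> 'a tpoly \<Rightarrow> 'a tpoly \<Rightarrow> 'a tpoly" where
  "homogenize m q X Y = (\<Sum>p\<le>m. Poly_Mapping.single 0 (poly.coeff q p) * (X ^ p * Y ^ (m - p)))"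

lemma homogenize_in_forms:
  assumes "X \<in> forms 1" "Y \<in> forms 1"
  shows "homogenize m q X Y \<in> forms m"
  unfolding homogenize_def
proof (rule forms_sum)
  fix p assume "p \<in> {..m}"
  then show "Poly_Mapping.single 0 (poly.coeff q p) * (X ^ p * Y ^ (m - p)) \<in> forms m"
    using forms_mult[OF forms_const forms_mult[OF forms_power[OF assms(1)] forms_power[OF assms(2)]],
        of "poly.coeff q p" p "m - p"]
    by simp
qed

lemma mult_at_least_homogenize:
  assumes "tp_eval X v = 0" "tp_eval Y v = 0"
  shows "mult_at_least v m (homogenize m q X Y)"
  unfolding homogenize_def
proof (rule mult_at_least_sum)
  fix p assume "p \<in> {..m}"
  moreover have "mult_at_least v (p + (m - p)) (X ^ p * Y ^ (m - p))"
    by (intro mult_at_least_mult mult_at_least_power assms)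
  moreover have "mult_at_least v 0 (Poly_Mapping.single 0 (poly.coeff q p))" by simp
  ultimately show "mult_at_least v m (Poly_Mapping.single 0 (poly.coeff q p) * (X ^ p * Y ^ (m - p)))"
    using mult_at_least_mult[of v 0 _ m] by simp
qed

lemma tp_eval_homogenize:
  assumes "degree q \<le> m" and "tp_eval X v = x * tp_eval Y v"
  shows "tp_eval (homogenize m q X Y) v = tp_eval Y v ^ m * poly q x"
proof -
  have "tp_eval (homogenize m q X Y) v =
      (\<Sum>p\<le>m. poly.coeff q p * ((x * tp_eval Y v) ^ p * tp_eval Y v ^ (m - p)))"
    using assms(2) by (simp add: homogenize_def tp_eval_single)
  also have "\<dots> = (\<Sum>p\<le>m. tp_eval Y v ^ m * (poly.coeff q p * x ^ p))"
  proof (rule sum.cong)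
    fix p assume "p \<in> {..m}"
    then have "tp_eval Y v ^ m = tp_eval Y v ^ p * tp_eval Y v ^ (m - p)"
      by (simp flip: power_add)
    then show "poly.coeff q p * ((x * tp_eval Y v) ^ p * tp_eval Y v ^ (m - p)) =
        tp_eval Y v ^ m * (poly.coeff q p * x ^ p)"
      by (simp add: power_mult_distrib mult_ac)
  qed simp
  also have "\<dots> = tp_eval Y v ^ m * poly q x"
    using poly_altdef[of q x] sum.mono_neutral_left[of "{..m}" "{..degree q}" "\<lambda>p. poly.coeff q p * x ^ p"] assms(1)
    by (simp add: coeff_eq_0 flip: sum_distrib_left)
  finally show ?thesis .
qed

text \<open>
  The monomials of degree \<open>d\<close> form a finite set that spans the forms. This matters because \<open>tp.dim\<close> is
  \<open>0\<close> on spaces of infinite dimension.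
\<close>
lemma forms_dim_pos:
  fixes V :: "'a::field tpoly set"
  assumes V: "V \<subseteq> forms d" and F: "F \<in> V" "F \<noteq> 0"
  shows "0 < tp.dim V"
proof -
  define E where "E = {e :: 3 \<Rightarrow>\<^sub>0 nat. (\<Sum>i\<in>UNIV. Poly_Mapping.lookup e i) = d}"
  have "finite E"
  proof (rule finite_imageD)
    have "Poly_Mapping.lookup e i \<le> d" if "e \<in> E" for e i
      using that sum_nonneg_leq_bound[of UNIV "Poly_Mapping.lookup e" d i] by (auto simp: E_def)
    then have "Poly_Mapping.lookup ` E \<subseteq> (UNIV \<rightarrow>\<^sub>E {..d})"
      by (auto simp: PiE_def extensional_def)
    moreover have "finite ((UNIV :: 3 set) \<rightarrow>\<^sub>E {..d})"
      by (rule finite_PiE) auto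
    ultimately show "finite (Poly_Mapping.lookup ` E)" by (rule finite_subset)
    show "inj_on Poly_Mapping.lookup E"
      by (meson inj_onI lookup_inject)
  qed
  define T where "T = (\<lambda>e. Poly_Mapping.single e (1::'a)) ` E"
  have "G \<in> tp.span T" if "G \<in> forms d" for G
  proof -
    have "G = (\<Sum>e\<in>Poly_Mapping.keys G. Poly_Mapping.single e (Poly_Mapping.lookup G e))"
      by (rule poly_mapping_eqI)
        (simp add: lookup_sum lookup_single when_def in_keys_iff)
    also have "\<dots> = (\<Sum>e\<in>Poly_Mapping.keys G. tp_scale (Poly_Mapping.lookup G e) (Poly_Mapping.single e 1))"
      by (simp add: tp_scale_def mult_single)
    also have "\<dots> \<in> tp.span T"
      using that by (intro tp.span_sum tp.span_scale tp.span_base) (auto simp: T_def E_def forms_def)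
    finally show ?thesis .
  qed
  then have span: "V \<subseteq> tp.span T" using V by blast
  obtain B where B: "B \<subseteq> V" "tp.independent B" "V \<subseteq> tp.span B" "card B = tp.dim V"
    using tp.basis_exists by blast
  have "finite B"
    using tp.independent_span_bound[OF _ B(2), of T] B(1) span \<open>finite E\<close> by (auto simp: T_def)
  moreover have "B \<noteq> {}" using B(3) F by auto
  ultimately show ?thesis using B(4) by (metis card_gt_0_iff)
qed

section \<open>Vectors, lines and planes in three-dimensional space\<close>

definition dot_prod :: "'a::field ^ 3 \<Rightarrow> 'a ^ 3 \<Rightarrow> 'a" where
  "dot_prod c v = (\<Sum>i\<in>UNIV. c $ i * v $ i)"

definition cross_prod :: "'a::field ^ 3 \<Rightarrow> 'a ^ 3 \<Rightarrow> 'a ^ 3" where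
  "cross_prod u v = vector [u $ 2 * v $ 3 - u $ 3 * v $ 2, u $ 3 * v $ 1 - u $ 1 * v $ 3, u $ 1 * v $ 2 - u $ 2 * v $ 1]"

lemmas triple_prod_expand = dot_prod_def cross_prod_def sum_3 vector_3

lemma dot_prod_add_right: "dot_prod c (v + w) = dot_prod c v + dot_prod c w"
  by (simp add: dot_prod_def sum.distrib distrib_left)

lemma dot_prod_scale_right: "dot_prod c (t *s v) = t * dot_prod c v"
  by (simp add: dot_prod_def sum_distrib_left mult_ac)

lemma dot_prod_scale_left: "dot_prod (t *s c) v = t * dot_prod c v"
  by (simp add: dot_prod_def sum_distrib_left mult_ac)

lemma dot_prod_diff_left: "dot_prod (b - c) v = dot_prod b v - dot_prod c v"
  by (simp add: dot_prod_def sum_subtractf left_diff_distrib)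

lemma dot_prod_zero_right [simp]: "dot_prod c 0 = 0"
  by (simp add: dot_prod_def)

lemma dot_prod_zero_left [simp]: "dot_prod 0 v = 0"
  by (simp add: dot_prod_def)

lemma dot_prod_cross_self [simp]:
  "dot_prod (cross_prod u v) u = 0" "dot_prod (cross_prod u v) v = 0"
  by (simp_all add: triple_prod_expand algebra_simps)

lemma triple_prod_cyclic: "dot_prod (cross_prod u v) w = dot_prod (cross_prod v w) u"
  by (simp add: triple_prod_expand algebra_simps)

text \<open>
  The coefficients are determinants of triples of the vectors: \<open>dot_prod (cross_prod p q) v\<close> is the
  determinant with columns \<open>p\<close>, \<open>q\<close>, \<open>v\<close>.
\<close>
lemma cramer_rule_3:
  "dot_prod (cross_prod p q) v *s w =
    dot_prod (cross_prod q v) w *s p + dot_prod (cross_prod v p) w *s q + dot_prod (cross_prod p q) w *s v"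
  by (simp add: Finite_Cartesian_Product.vec_eq_iff forall_3 triple_prod_expand algebra_simps)

lemma ex_dot_prod_nonzero:
  fixes c :: "'a::field ^ 3"
  assumes "c \<noteq> 0"
  obtains w where "dot_prod c w \<noteq> 0"
proof -
  obtain i where "c $ i \<noteq> 0" using assms by (auto simp: Finite_Cartesian_Product.vec_eq_iff)
  then have "dot_prod c (axis i 1) \<noteq> 0"
    by (simp add: dot_prod_def axis_def if_distrib cong: if_cong)
  then show thesis by (rule that)
qed

lemma cross_prod_eq_0_imp_scale:
  fixes u v :: "'a::field ^ 3"
  assumes "u \<noteq> 0" "cross_prod u v = 0"
  obtains t where "v = t *s u"
proof -
  obtain i where i: "u $ i \<noteq> 0" using assms by (auto simp: Finite_Cartesian_Product.vec_eq_iff)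
  have "u $ 2 * v $ 3 = u $ 3 * v $ 2" "u $ 3 * v $ 1 = u $ 1 * v $ 3" "u $ 1 * v $ 2 = u $ 2 * v $ 1"
    using assms(2) by (simp_all add: Finite_Cartesian_Product.vec_eq_iff forall_3 cross_prod_def vector_3)
  then have "v $ j * u $ i = v $ i * u $ j" for j
    using exhaust_3[of i] exhaust_3[of j] by (auto simp: mult.commute)
  then have "v = (v $ i / u $ i) *s u"
    using i by (simp add: Finite_Cartesian_Product.vec_eq_iff field_simps)
  then show thesis by (rule that)
qed

text \<open>
  A vector off the planes treated so far is moved in a direction \<open>w\<close> transversal to the next one; each
  of the finitely many planes excludes at most one step length, and the field is infinite.
\<close>
lemma avoid_finitely_many_planes:
  fixes C :: "('a::field_char_0 ^ 3) set"
  assumes "finite C" "0 \<notin> C"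
  obtains v where "\<And>c. c \<in> C \<Longrightarrow> dot_prod c v \<noteq> 0"
  using assms
proof (induction C arbitrary: thesis rule: finite_induct)
  case empty
  then show ?case by blast
next
  case (insert c C)
  obtain v where v: "\<And>c. c \<in> C \<Longrightarrow> dot_prod c v \<noteq> 0"
    using insert by blast
  obtain w where w: "dot_prod c w \<noteq> 0"
    using insert.prems by (auto elim: ex_dot_prod_nonzero)
  show ?case
  proof (cases "dot_prod c v = 0")
    case False
    with v insert.prems(1) show ?thesis by (metis insert_iff)
  next
    case True
    \<comment> \<open>The step lengths excluded by \<open>c\<close> itself and by the earlier planes.\<close>
    define T where "T = insert 0 ((\<lambda>e. - dot_prod e v / dot_prod e w) ` C)"
    have "finite T" using insert.hyps by (simp add: T_def)
    then obtain t where t: "t \<notin> T"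
      using ex_new_if_finite infinite_UNIV_char_0 by blast
    have "dot_prod e (v + t *s w) \<noteq> 0" if "e \<in> insert c C" for e
    proof
      assume zero: "dot_prod e (v + t *s w) = 0"
      show False
      proof (cases "e = c")
        assume "e = c"
        with zero True t w show False
          by (simp add: dot_prod_add_right dot_prod_scale_right T_def)
      next
        assume "e \<noteq> c"
        then have e: "e \<in> C" using that by simp
        have eq: "dot_prod e v + t * dot_prod e w = 0"
          using zero by (simp add: dot_prod_add_right dot_prod_scale_right)
        then have "dot_prod e w \<noteq> 0" using v[OF e] by auto
        with eq have "t = - dot_prod e v / dot_prod e w"
          by (simp add: field_simps add_eq_0_iff2)
        with e t show False by (auto simp: T_def)
      qed
    qed
    then show ?thesis by (rule insert.prems(1))
  qed
qed

lemma proj_point_eq_span: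
  assumes "P \<in> proj_plane"
  shows "\<exists>p. p \<noteq> 0 \<and> P = range (\<lambda>t. t *s p)"
proof -
  have P: "vec.subspace P" "vec.dim P = 1" using assms by (auto simp: proj_plane_def)
  obtain B where B: "B \<subseteq> P" "vec.independent B" "P \<subseteq> vec.span B" "card B = vec.dim P"
    using vec.basis_exists by blast
  then obtain p where p: "B = {p}" using P(2) by (auto simp: card_1_singleton_iff)
  have "p \<noteq> 0" using B(2) p vec.dependent_zero by blast
  moreover have "P = vec.span {p}"
    using B P(1) p vec.span_minimal by blast
  ultimately show ?thesis by (auto simp: vec.span_singleton)
qed

lemma range_scale_eqI:
  fixes p q :: "'a::field ^ 3"
  assumes "q \<in> range (\<lambda>t. t *s p)" "q \<noteq> 0"
  shows "range (\<lambda>t. t *s q) = range (\<lambda>t. t *s p)"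
proof -
  obtain t where t: "q = t *s p" using assms by auto
  then have "t \<noteq> 0" using assms by auto
  then have p: "p = inverse t *s q" by (simp add: t)
  show ?thesis
  proof (intro equalityI subsetI)
    fix x assume "x \<in> range (\<lambda>s. s *s q)"
    then show "x \<in> range (\<lambda>s. s *s p)" by (auto simp: t)
  next
    fix x assume "x \<in> range (\<lambda>s. s *s p)"
    then obtain s where "x = s *s p" by auto
    then have "x = (s * inverse t) *s q" using p by simp
    then show "x \<in> range (\<lambda>s. s *s q)" by blast
  qed
qed

lemma proj_point_of_vector:
  fixes v :: "'a::field ^ 3"
  assumes "v \<noteq> 0"
  shows "range (\<lambda>t. t *s v) \<in> proj_plane"
proof -
  have "vec.independent {v}" using assms by (simp add: vec.dependent_single)
  then have "vec.dim (vec.span {v}) = 1" using vec.dim_span_eq_card_independent[of "{v}"] by simp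
  then show ?thesis
    using vec.subspace_span[of "{v}"] by (simp add: proj_plane_def vec.span_singleton)
qed

text \<open>
  Cramer's rule writes a vector orthogonal to \<open>cross_prod p q\<close> as a combination of \<open>p\<close> and \<open>q\<close>.
\<close>
lemma plane_eq_normal:
  fixes p q :: "'a::field ^ 3"
  assumes W: "vec.subspace W" "vec.dim W = 2" and p: "p \<in> W" and q: "q \<in> W"
    and pq: "cross_prod p q \<noteq> 0"
  shows "W = {w. dot_prod (cross_prod p q) w = 0}"
proof -
  let ?H = "{w. dot_prod (cross_prod p q) w = 0}"
  have "q \<noteq> 0" "p \<noteq> t *s q" for t
    using pq by (auto simp: cross_prod_def Finite_Cartesian_Product.vec_eq_iff forall_3 vector_3)
  then have notin: "q \<noteq> 0" "p \<notin> vec.span {q}"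
    by (auto simp: vec.span_singleton)
  then have "vec.independent {p, q}"
    by (simp add: vec.independent_insert vec.dependent_single)
  moreover have "p \<noteq> q" using notin vec.span_base by blast
  ultimately have dim: "vec.dim (vec.span {p, q}) = 2"
    using vec.dim_span_eq_card_independent[of "{p, q}"] by simp
  have "vec.span {p, q} \<subseteq> W"
    using p q W(1) by (intro vec.span_minimal) auto
  then have WS: "W = vec.span {p, q}"
    using vec.subspace_dim_equal[OF vec.subspace_span W(1), of "{p, q}"] dim W(2) by simp
  have "vec.subspace ?H"
    by (auto simp: vec.subspace_def dot_prod_add_right dot_prod_scale_right)
  then have "W \<subseteq> ?H" unfolding WS by (intro vec.span_minimal) auto
  moreover have "?H \<subseteq> W"
  proof
    fix v assume "v \<in> ?H"
    then have v: "dot_prod (cross_prod p q) v = 0" by simp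
    obtain w where w: "dot_prod (cross_prod p q) w \<noteq> 0"
      using pq by (rule ex_dot_prod_nonzero)
    let ?c = "dot_prod (cross_prod p q) w"
    have "dot_prod (cross_prod q v) w *s p + dot_prod (cross_prod v p) w *s q + ?c *s v = 0"
      using cramer_rule_3[of p q v w] v by simp
    then have "?c *s v = - (dot_prod (cross_prod q v) w *s p + dot_prod (cross_prod v p) w *s q)"
      by (simp only: add_eq_0_iff)
    also have "\<dots> \<in> W"
      by (intro vec.subspace_neg vec.subspace_add vec.subspace_scale W p q)
    finally have "(1 / ?c) *s (?c *s v) \<in> W"
      by (rule vec.subspace_scale[OF W(1)])
    then show "v \<in> W" using w by simp
  qed
  ultimately show ?thesis by blast
qed

section \<open>Curves with a prescribed singular point\<close>

text \<open>
  The determinants \<open>\<alpha>\<close>, \<open>\<beta>\<close>, \<open>\<gamma>\<close> are, up to the common factor \<open>\<gamma> w\<close>, the coordinates with respect to \<open>u\<close>,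
  \<open>v\<close>, \<open>w\<close>, and \<open>\<gamma> = 0\<close> is the line at infinity. The form is the homogenization of \<open>a * h b + k b\<close> with
  \<open>a = \<alpha> / \<gamma>\<close> and \<open>b = \<beta> / \<gamma>\<close>. Since \<open>\<beta>\<close> and \<open>\<gamma>\<close> vanish at \<open>u\<close>, a form of degree \<open>m\<close> in \<open>\<beta>\<close> and \<open>\<gamma>\<close> alone
  vanishes there to order \<open>m\<close>.
\<close>
lemma curve_from_interpolation:
  fixes u v w :: "'a::field_char_0 ^ 3" and h k :: "'a poly" and p :: "nat \<Rightarrow> 'a ^ 3" and n :: nat
  defines "\<alpha> x \<equiv> dot_prod (cross_prod v w) x" and "\<beta> x \<equiv> dot_prod (cross_prod w u) x"
    and "\<gamma> x \<equiv> dot_prod (cross_prod u v) x"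
  assumes d: "0 < d" and hk: "h \<noteq> 0 \<or> k \<noteq> 0" "degree h \<le> d - 1" "degree k \<le> d"
    and uvw: "\<gamma> w \<noteq> 0"
    and p: "\<And>i. i < n \<Longrightarrow> \<gamma> (p i) \<noteq> 0"
    and vanish: "\<And>i. i < n \<Longrightarrow>
      \<alpha> (p i) / \<gamma> (p i) * poly h (\<beta> (p i) / \<gamma> (p i)) + poly k (\<beta> (p i) / \<gamma> (p i)) = 0"
  obtains F where "F \<in> forms d" "F \<noteq> 0"
    "\<And>i. i < n \<Longrightarrow> vanishes_at F (range (\<lambda>t. t *s p i))"
    "vanishes_to_order (d - 1) F (range (\<lambda>t. t *s u))"
proof -
  define X where "X = linear_form (cross_prod w u)"
  define Y where "Y = linear_form (cross_prod u v)"
  define A where "A = linear_form (cross_prod v w)"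
  have eval: "tp_eval X x = \<beta> x" "tp_eval Y x = \<gamma> x" "tp_eval A x = \<alpha> x" for x
    by (simp_all add: X_def Y_def A_def \<alpha>_def \<beta>_def \<gamma>_def dot_prod_def tp_eval_linear_form)
  have XYA: "X \<in> forms 1" "Y \<in> forms 1" "A \<in> forms 1"
    by (simp_all add: X_def Y_def A_def linear_form_in_forms[simplified])
  define F where "F = A * homogenize (d - 1) h X Y + homogenize d k X Y"
  have eval_F: "tp_eval F x = \<gamma> x ^ d * (a * poly h b + poly k b)"
    if "\<alpha> x = a * \<gamma> x" "\<beta> x = b * \<gamma> x" for x a b
  proof -
    have X: "tp_eval X x = b * tp_eval Y x" using that by (simp add: eval)
    have "tp_eval F x = a * \<gamma> x * (\<gamma> x ^ (d - 1) * poly h b) + \<gamma> x ^ d * poly k b"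
      using that by (simp add: F_def tp_eval_homogenize[OF hk(2) X] tp_eval_homogenize[OF hk(3) X] eval del: One_nat_def)
    also have "\<gamma> x ^ d = \<gamma> x * \<gamma> x ^ (d - 1)"
      using d by (cases d) simp_all
    finally show ?thesis using d by (cases d) (simp_all add: algebra_simps)
  qed
  show thesis
  proof (rule that)
    show "F \<in> forms d"
      using forms_mult[OF XYA(3) homogenize_in_forms[OF XYA(1,2)], of "d - 1" h]
        homogenize_in_forms[OF XYA(1,2), of d k] d by (auto simp: F_def intro: forms_add)
    show "F \<noteq> 0"
    proof -
      obtain y where y: "poly h y \<noteq> 0 \<or> poly k y \<noteq> 0"
        using hk(1) poly_eq_poly_eq_iff[of h 0] poly_eq_poly_eq_iff[of k 0] by (auto simp: fun_eq_iff)
      then obtain x where x: "x * poly h y + poly k y \<noteq> 0"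
        by (cases "poly k y = 0") (auto intro: that[of 1] that[of 0])
      define q where "q = x *s u + y *s v + w"
      have coords: "\<alpha> q = x * \<gamma> w" "\<beta> q = y * \<gamma> w" "\<gamma> q = \<gamma> w"
        unfolding q_def \<alpha>_def \<beta>_def \<gamma>_def
        by (simp_all add: dot_prod_add_right dot_prod_scale_right triple_prod_cyclic[of v w u]
            triple_prod_cyclic[of w u v])
      have "tp_eval F q = \<gamma> w ^ d * (x * poly h y + poly k y)"
        using eval_F[of q x y] by (simp add: coords)
      then show ?thesis using x uvw by auto
    qed
    show "vanishes_at F (range (\<lambda>t. t *s p i))" if i: "i < n" for i
      unfolding vanishes_at_def
    proof
      fix x assume "x \<in> range (\<lambda>t. t *s p i) - {0}"
      then obtain t where t: "x = t *s p i" by auto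
      have "tp_eval F x = \<gamma> x ^ d * (\<alpha> (p i) / \<gamma> (p i) * poly h (\<beta> (p i) / \<gamma> (p i)) + poly k (\<beta> (p i) / \<gamma> (p i)))"
        by (rule eval_F) (use p[OF i] in \<open>simp_all add: t \<alpha>_def \<beta>_def \<gamma>_def dot_prod_scale_right\<close>)
      then show "tp_eval F x = 0" using vanish[OF i] by simp
    qed
    show "vanishes_to_order (d - 1) F (range (\<lambda>t. t *s u))"
    proof (rule vanishes_to_orderI)
      fix x assume "x \<in> range (\<lambda>t. t *s u)"
      then have "tp_eval X x = 0" "tp_eval Y x = 0"
        by (auto simp: eval \<beta>_def \<gamma>_def dot_prod_scale_right)
      note hom = mult_at_least_homogenize[OF this]
      have "mult_at_least x (0 + (d - 1)) (A * homogenize (d - 1) h X Y)"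
        by (rule mult_at_least_mult) (simp_all add: hom)
      moreover have "mult_at_least x (d - 1) (homogenize d k X Y)"
        by (rule mult_at_least_mono[OF hom]) simp
      ultimately show "mult_at_least x (d - 1) F"
        by (simp add: F_def mult_at_least_add)
    qed
  qed
qed

text \<open>
  The line through \<open>u\<close> and \<open>v\<close> has to miss the points \<open>p i\<close>, and to meet the lines with normal vectors
  \<open>N L\<close> in pairwise distinct points \<open>u + \<tau> v\<close> with finite \<open>\<tau>\<close>. Each of these conditions says that some
  nonzero linear form does not vanish at \<open>v\<close>.
\<close>
lemma generic_line_through_point:
  fixes u :: "'a::field_char_0 ^ 3" and p :: "nat \<Rightarrow> 'a ^ 3" and N :: "'l \<Rightarrow> 'a ^ 3"
  assumes p: "\<And>i. i < n \<Longrightarrow> cross_prod (p i) u \<noteq> 0"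
    and fin: "finite \<L>"
    and N: "\<And>L. L \<in> \<L> \<Longrightarrow> dot_prod (N L) u \<noteq> 0"
    and indep: "\<And>L L'. L \<in> \<L> \<Longrightarrow> L' \<in> \<L> \<Longrightarrow> L \<noteq> L' \<Longrightarrow> N L' \<notin> range (\<lambda>t. t *s N L)"
  obtains v where "\<And>i. i < n \<Longrightarrow> dot_prod (cross_prod u v) (p i) \<noteq> 0"
    "\<And>L. L \<in> \<L> \<Longrightarrow> dot_prod (N L) v \<noteq> 0"
    "inj_on (\<lambda>L. - dot_prod (N L) u / dot_prod (N L) v) \<L>"
proof -
  \<comment> \<open>\<open>G L L'\<close> vanishes at \<open>v\<close> exactly if the two lines meet the line through \<open>u\<close> and \<open>v\<close> in the same point.\<close>
  define G where "G L L' = dot_prod (N L) u *s N L' - dot_prod (N L') u *s N L" for L L'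
  have G: "G L L' \<noteq> 0" if "L \<in> \<L>" "L' \<in> \<L>" "L \<noteq> L'" for L L'
  proof
    assume "G L L' = 0"
    then have eq: "dot_prod (N L) u *s N L' = dot_prod (N L') u *s N L" by (simp add: G_def)
    have "N L' = (1 / dot_prod (N L) u) *s (dot_prod (N L) u *s N L')"
      using N[OF that(1)] by simp
    also have "\<dots> = (dot_prod (N L') u / dot_prod (N L) u) *s N L"
      unfolding eq by simp
    finally show False using indep[OF that] by blast
  qed
  define C where "C = (\<lambda>i. cross_prod (p i) u) ` {..<n} \<union> N ` \<L> \<union>
    (\<lambda>(L, L'). G L L') ` ({(L, L'). L \<noteq> L'} \<inter> \<L> \<times> \<L>)"
  have "finite C" using fin by (auto simp: C_def)
  moreover have "0 \<notin> C"
  proof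
    assume "0 \<in> C"
    then consider i where "i < n" "cross_prod (p i) u = 0" | L where "L \<in> \<L>" "N L = 0"
      | L L' where "L \<in> \<L>" "L' \<in> \<L>" "L \<noteq> L'" "G L L' = 0"
      by (auto simp: C_def)
    then show False
    proof cases
      case 1
      with p show ?thesis by blast
    next
      case 2
      with N[of L] show ?thesis by simp
    next
      case 3
      with G show ?thesis by blast
    qed
  qed
  ultimately obtain v where v: "\<And>c. c \<in> C \<Longrightarrow> dot_prod c v \<noteq> 0"
    using avoid_finitely_many_planes by blast
  show thesis
  proof (rule that)
    show "dot_prod (cross_prod u v) (p i) \<noteq> 0" if "i < n" for i
      using v[of "cross_prod (p i) u"] that by (auto simp: C_def triple_prod_cyclic[of "p i" u v])
    show Nv: "dot_prod (N L) v \<noteq> 0" if "L \<in> \<L>" for L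
      using v[of "N L"] that by (auto simp: C_def)
    show "inj_on (\<lambda>L. - dot_prod (N L) u / dot_prod (N L) v) \<L>"
    proof (rule inj_onI, rule ccontr)
      fix L L' assume L: "L \<in> \<L>" "L' \<in> \<L>" "L \<noteq> L'"
        and eq: "- dot_prod (N L) u / dot_prod (N L) v = - dot_prod (N L') u / dot_prod (N L') v"
      have "G L L' \<in> C" using L by (auto simp: C_def)
      then have "dot_prod (G L L') v \<noteq> 0" by (rule v)
      moreover have "dot_prod (N L) u * dot_prod (N L') v = dot_prod (N L') u * dot_prod (N L) v"
        using eq Nv[OF L(1)] Nv[OF L(2)] by (simp add: field_simps)
      ultimately show False
        by (simp add: G_def dot_prod_diff_left dot_prod_scale_left)
    qed
  qed
qed

text \<open>
  In the affine coordinates \<open>a = \<alpha> / \<gamma>\<close>, \<open>b = \<beta> / \<gamma>\<close> the line with normal vector \<open>N L\<close> has slope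
  \<open>- (N L \<cdot> u) / (N L \<cdot> v)\<close>, and \<open>b\<close> separates two points unless they are collinear with \<open>u\<close>.
\<close>
lemma curve_with_singularity_at:
  fixes u :: "'a::field_char_0 ^ 3" and p :: "nat \<Rightarrow> 'a ^ 3" and N :: "'l \<Rightarrow> 'a ^ 3"
  assumes d: "0 < d" and n: "n = 2 * d + 2"
    and u: "\<And>i j. i < n \<Longrightarrow> j < n \<Longrightarrow> i \<noteq> j \<Longrightarrow> dot_prod (cross_prod (p i) (p j)) u \<noteq> 0"
    and fin: "finite \<L>"
    and N: "\<And>L. L \<in> \<L> \<Longrightarrow> dot_prod (N L) u \<noteq> 0"
    and indep: "\<And>L L'. L \<in> \<L> \<Longrightarrow> L' \<in> \<L> \<Longrightarrow> L \<noteq> L' \<Longrightarrow> N L' \<notin> range (\<lambda>t. t *s N L)"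
    and S: "\<And>L. L \<in> \<L> \<Longrightarrow> S L \<subseteq> {..<n}"
    and line: "\<And>L i. L \<in> \<L> \<Longrightarrow> i \<in> S L \<Longrightarrow> dot_prod (N L) (p i) = 0"
    and many: "d\<^sup>2 < (\<Sum>L\<in>\<L>. (card (S L) - 1) choose 2)"
  obtains F where "F \<in> forms d" "F \<noteq> 0"
    "\<And>i. i < n \<Longrightarrow> vanishes_at F (range (\<lambda>t. t *s p i))"
    "vanishes_to_order (d - 1) F (range (\<lambda>t. t *s u))"
proof -
  have pu: "cross_prod (p i) u \<noteq> 0" if i: "i < n" for i
  proof
    assume zero: "cross_prod (p i) u = 0"
    \<comment> \<open>Any other index serves: a vector proportional to \<open>p i\<close> lies on the line through \<open>p i\<close> and \<open>p j\<close>.\<close>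
    define j where "j = (if i = 0 then 1 else 0 :: nat)"
    have "j < n" "i \<noteq> j" using n by (auto simp: j_def)
    with u[OF i] have "dot_prod (cross_prod (p i) (p j)) u \<noteq> 0" by blast
    moreover have "dot_prod (cross_prod (p i) (p j)) u = - dot_prod (cross_prod (p i) u) (p j)"
      by (simp add: triple_prod_expand algebra_simps)
    ultimately show False using zero by simp
  qed
  obtain v where v: "\<And>i. i < n \<Longrightarrow> dot_prod (cross_prod u v) (p i) \<noteq> 0"
    and Nv: "\<And>L. L \<in> \<L> \<Longrightarrow> dot_prod (N L) v \<noteq> 0"
    and inj: "inj_on (\<lambda>L. - dot_prod (N L) u / dot_prod (N L) v) \<L>"
    by (rule generic_line_through_point[of n p u \<L> N, OF pu fin N indep]) blast+
  \<comment> \<open>Any vector off the plane of \<open>u\<close> and \<open>v\<close> completes the basis.\<close>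
  define w where "w = p 0"
  define \<alpha> where "\<alpha> x = dot_prod (cross_prod v w) x" for x
  define \<beta> where "\<beta> x = dot_prod (cross_prod w u) x" for x
  define \<gamma> where "\<gamma> x = dot_prod (cross_prod u v) x" for x
  have \<gamma>w: "\<gamma> w \<noteq> 0" using v[of 0] n by (simp add: \<gamma>_def w_def)
  have \<gamma>p: "\<gamma> (p i) \<noteq> 0" if "i < n" for i using v[OF that] by (simp add: \<gamma>_def)
  define a where "a i = \<alpha> (p i) / \<gamma> (p i)" for i
  define b where "b i = \<beta> (p i) / \<gamma> (p i)" for i
  have b_inj: "inj_on b {..<n}"
  proof (rule inj_onI, rule ccontr)
    fix i j assume ij: "i \<in> {..<n}" "j \<in> {..<n}" "b i = b j" "i \<noteq> j"
    have "\<beta> (p i) * \<gamma> (p j) = \<beta> (p j) * \<gamma> (p i)"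
      using ij(3) \<gamma>p[of i] \<gamma>p[of j] ij(1,2) by (simp add: b_def field_simps)
    moreover have "\<gamma> w * dot_prod (cross_prod (p i) (p j)) u = \<beta> (p i) * \<gamma> (p j) - \<beta> (p j) * \<gamma> (p i)"
      by (simp add: \<beta>_def \<gamma>_def triple_prod_expand algebra_simps)
    ultimately show False using \<gamma>w u[of i j] ij by simp
  qed
  have on_line: "b i = - dot_prod (N L) w / dot_prod (N L) v + - dot_prod (N L) u / dot_prod (N L) v * a i"
    if L: "L \<in> \<L>" "i \<in> S L" for L i
  proof -
    have i: "i < n" using S L by auto
    have solve: "y = - z - x" if "x + y + z = 0" for x y z :: 'a
    proof -
      have "y = (x + y + z) - z - x" by simp
      then show ?thesis unfolding that by simp
    qed
    have "\<gamma> w *s p i = \<alpha> (p i) *s u + \<beta> (p i) *s v + \<gamma> (p i) *s w"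
      unfolding \<alpha>_def \<beta>_def \<gamma>_def by (rule cramer_rule_3)
    from arg_cong[OF this, of "dot_prod (N L)"]
    have "\<alpha> (p i) * dot_prod (N L) u + \<beta> (p i) * dot_prod (N L) v + \<gamma> (p i) * dot_prod (N L) w = 0"
      by (simp add: dot_prod_add_right dot_prod_scale_right line[OF L])
    then have "\<beta> (p i) * dot_prod (N L) v = - (\<gamma> (p i) * dot_prod (N L) w) - \<alpha> (p i) * dot_prod (N L) u"
      using solve by blast
    then show ?thesis
      using Nv[OF L(1)] \<gamma>p[OF i] by (simp add: a_def b_def field_simps)
  qed
  obtain h k where hk: "h \<noteq> 0 \<or> k \<noteq> 0" "degree h \<le> d - 1" "degree k \<le> d"
    "\<And>i. i < n \<Longrightarrow> a i * poly h (b i) + poly k (b i) = 0"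
    using bivariate_interpolation_low_degree[OF d n b_inj fin inj S on_line many] by blast
  show thesis
  proof (rule curve_from_interpolation[OF d hk(1-3), of u v w n p])
    show "dot_prod (cross_prod u v) w \<noteq> 0" using \<gamma>w by (simp add: \<gamma>_def)
    show "dot_prod (cross_prod u v) (p i) \<noteq> 0" if "i < n" for i by (rule v[OF that])
    show "dot_prod (cross_prod v w) (p i) / dot_prod (cross_prod u v) (p i) *
        poly h (dot_prod (cross_prod w u) (p i) / dot_prod (cross_prod u v) (p i)) +
        poly k (dot_prod (cross_prod w u) (p i) / dot_prod (cross_prod u v) (p i)) = 0" if "i < n" for i
      using hk(4)[OF that] by (simp only: a_def b_def \<alpha>_def \<beta>_def \<gamma>_def)
  qed (fact that)
qed

lemma line_eq_normal:
  assumes L: "L \<in> proj_lines" and pts: "range (\<lambda>t. t *s p) \<in> L" "range (\<lambda>t. t *s q) \<in> L"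
    and pq: "cross_prod p q \<noteq> 0"
  shows "L = {P \<in> proj_plane. P \<subseteq> {w. dot_prod (cross_prod p q) w = 0}}"
proof -
  obtain W where W: "L = {P \<in> proj_plane. P \<subseteq> W}" "vec.subspace W" "vec.dim W = 2"
    using L by (auto simp: proj_lines_def)
  have gen: "x \<in> range (\<lambda>t. t *s x)" for x :: "'a ^ 3"
    by (rule image_eqI[of _ _ 1]) simp_all
  have "p \<in> W" "q \<in> W" using pts gen W(1) by blast+
  from plane_eq_normal[OF W(2,3) this pq] W(1) show ?thesis by simp
qed

theorem theorem4p2:
  fixes d m s :: nat
    and P :: "nat \<Rightarrow> ('a::field_char_0 ^ 3) set"
    and Z :: "('a ^ 3) set set"
  assumes "0 < d" and "0 < m" and "m = d - 1"
    and "int s = int ((d + 2) choose 2) - int (d choose 2) + 1"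
    and "\<And>i. i \<in> {1..s} \<Longrightarrow> P i \<in> proj_plane"
    and "inj_on P {1..s}"
    and "Z = P ` {1..s}"
    and "imposes_independent_conditions Z d"
    and "(\<Sum>L \<in> {L \<in> proj_lines. Z \<inter> L \<noteq> {} \<and> card (Z \<inter> L) \<ge> 3}.
            int ((card (Z \<inter> L) - 1) choose 2)) + int d - int s + 2 > 2 * int (d choose 2)"
  shows "admits_unexpected_curve Z d (d - 1)"
proof -
  define \<L> where "\<L> = {L \<in> proj_lines. Z \<inter> L \<noteq> {} \<and> card (Z \<inter> L) \<ge> 3}"
  have choose2: "2 * int (n choose 2) = int n * (int n - 1)" for n
    by (induction n) (auto simp: numeral_2_eq_2 algebra_simps)
  have s: "s = 2 * d + 2"
    using assms(4) choose2[of "d + 2"] choose2[of d] by (simp add: algebra_simps)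
  have sum_int: "int (d\<^sup>2) < (\<Sum>L\<in>\<L>. int ((card (Z \<inter> L) - 1) choose 2))"
    using assms(9) choose2[of d] unfolding \<L>_def[symmetric] s by (simp add: power2_eq_square algebra_simps)
  have fin: "finite \<L>"
  proof (rule ccontr)
    assume "infinite \<L>"
    \<comment> \<open>A sum over an infinite set is \<open>0\<close> by convention, against the lower bound \<open>d\<^sup>2\<close>.\<close>
    with sum_int show False by (simp add: sum.infinite)
  qed
  have "\<exists>p. p \<noteq> 0 \<and> P (Suc i) = range (\<lambda>t. t *s p)" if "i < s" for i
    using assms(5)[of "Suc i"] that by (intro proj_point_eq_span) auto
  then obtain p where p: "\<And>i. i < s \<Longrightarrow> p i \<noteq> 0" "\<And>i. i < s \<Longrightarrow> P (Suc i) = range (\<lambda>t. t *s p i)"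
    by metis
  have Z: "Z = (\<lambda>i. P (Suc i)) ` {..<s}"
    unfolding assms(7) image_Suc_lessThan[symmetric] image_image ..
  have P_inj: "inj_on (\<lambda>i. P (Suc i)) {..<s}"
    using comp_inj_on[of Suc "{..<s}" P] assms(6) by (simp add: image_Suc_lessThan o_def)
  have pp: "cross_prod (p i) (p j) \<noteq> 0" if ij: "i < s" "j < s" "i \<noteq> j" for i j
  proof
    assume "cross_prod (p i) (p j) = 0"
    then obtain t where "p j = t *s p i"
      using cross_prod_eq_0_imp_scale[OF p(1)[OF ij(1)]] by blast
    then have "P (Suc j) = P (Suc i)"
      unfolding p(2)[OF ij(1)] p(2)[OF ij(2)] using p(1)[OF ij(2)] by (intro range_scale_eqI) auto
    with P_inj ij show False by (auto dest: inj_onD)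
  qed
  define S where "S L = {i. i < s \<and> P (Suc i) \<in> L}" for L
  have card_S: "card (Z \<inter> L) = card (S L)" for L
  proof -
    have "Z \<inter> L = (\<lambda>i. P (Suc i)) ` S L" by (auto simp: Z S_def)
    then show ?thesis
      using card_image[OF inj_on_subset[OF P_inj, of "S L"]] by (auto simp: S_def)
  qed
  have "\<exists>i j. i \<in> S L \<and> j \<in> S L \<and> i \<noteq> j" if "L \<in> \<L>" for L
  proof -
    have "\<not> (\<exists>x. S L \<subseteq> {x})"
    proof
      assume "\<exists>x. S L \<subseteq> {x}"
      then obtain x where "S L \<subseteq> {x}" by blast
      then have "card (S L) \<le> card {x}" by (intro card_mono) auto
      with that card_S[of L] show False by (simp add: \<L>_def)
    qed
    then show ?thesis by blast
  qed
  then obtain I J where IJ: "\<And>L. L \<in> \<L> \<Longrightarrow> I L \<in> S L" "\<And>L. L \<in> \<L> \<Longrightarrow> J L \<in> S L"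
    "\<And>L. L \<in> \<L> \<Longrightarrow> I L \<noteq> J L" by metis
  \<comment> \<open>A normal vector of \<open>L\<close>, obtained from two points of \<open>Z\<close> on it.\<close>
  define N where "N L = cross_prod (p (I L)) (p (J L))" for L
  have N: "L = {Q \<in> proj_plane. Q \<subseteq> {w. dot_prod (N L) w = 0}}" if L: "L \<in> \<L>" for L
    unfolding N_def
  proof (rule line_eq_normal)
    show "L \<in> proj_lines" using L by (simp add: \<L>_def)
    show "range (\<lambda>t. t *s p (I L)) \<in> L" "range (\<lambda>t. t *s p (J L)) \<in> L"
      using IJ(1,2)[OF L] p(2) by (auto simp: S_def)
    show "cross_prod (p (I L)) (p (J L)) \<noteq> 0"
      using IJ[OF L] by (intro pp) (auto simp: S_def)
  qed
  have N0: "N L \<noteq> 0" if "L \<in> \<L>" for L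
    unfolding N_def using IJ[OF that] by (intro pp) (auto simp: S_def)
  have indep: "N L' \<notin> range (\<lambda>t. t *s N L)" if L: "L \<in> \<L>" "L' \<in> \<L>" "L \<noteq> L'" for L L'
  proof
    assume "N L' \<in> range (\<lambda>t. t *s N L)"
    then obtain t where t: "N L' = t *s N L" by auto
    with N0[OF L(2)] have "t \<noteq> 0" by auto
    then have "dot_prod (N L') w = 0 \<longleftrightarrow> dot_prod (N L) w = 0" for w
      by (simp add: t dot_prod_scale_left)
    then have "L = L'" using N[OF L(1)] N[OF L(2)] by simp
    with L show False by simp
  qed
  have line: "dot_prod (N L) (p i) = 0" if L: "L \<in> \<L>" and i: "i \<in> S L" for L i
  proof -
    have "range (\<lambda>t. t *s p i) \<subseteq> {w. dot_prod (N L) w = 0}"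
      using N[OF L] i p(2)[of i] by (auto simp: S_def)
    moreover have "p i \<in> range (\<lambda>t. t *s p i)"
      by (rule image_eqI[of _ _ 1]) simp_all
    ultimately show ?thesis by blast
  qed
  have many: "d\<^sup>2 < (\<Sum>L\<in>\<L>. (card (S L) - 1) choose 2)"
    using sum_int unfolding card_S by (simp only: of_nat_sum[symmetric] of_nat_less_iff)
  define C where "C = (\<lambda>(i, j). cross_prod (p i) (p j)) ` ({..<s} \<times> {..<s} \<inter> {(i, j). i \<noteq> j})"
  have C: "finite C" "0 \<notin> C" using pp by (auto simp: C_def)
  \<comment> \<open>The open set is the complement of the lines joining two points of \<open>Z\<close>.\<close>
  define Q where "Q = (\<Prod>c\<in>C. linear_form c)"
  have eval_Q: "tp_eval Q v = 0 \<longleftrightarrow> (\<exists>c\<in>C. dot_prod c v = 0)" for v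
    using C by (auto simp: Q_def tp_eval_linear_form dot_prod_def)
  have Q: "Q \<in> (\<Union>e. forms e)"
    unfolding Q_def using C(1)
  proof (induction C rule: finite_induct)
    case empty
    then show ?case using forms_one by auto
  next
    case (insert c C)
    then show ?case using forms_mult[OF linear_form_in_forms] by fastforce
  qed
  define U where "U = {B \<in> proj_plane. \<not> vanishes_at Q B}"
  have "zariski_open U"
    unfolding zariski_open_def U_def using Q by (intro exI[of _ "{Q}"]) auto
  moreover have "U \<noteq> {}"
  proof -
    obtain v where v: "\<And>c. c \<in> C \<Longrightarrow> dot_prod c v \<noteq> 0"
      using avoid_finitely_many_planes[OF C] by blast
    have "cross_prod (p 0) (p 1) \<in> C" using s by (force simp: C_def)
    from v[OF this] have "v \<noteq> 0" by auto
    moreover have "v \<in> range (\<lambda>t. t *s v)"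
      by (rule image_eqI[of _ _ 1]) simp_all
    ultimately have "range (\<lambda>t. t *s v) \<in> U"
      using v eval_Q[of v] proj_point_of_vector[of v] by (auto simp: U_def vanishes_at_def)
    then show ?thesis by blast
  qed
  moreover have "int (tp.dim {F \<in> forms_vanishing_on d Z. vanishes_to_order (d - 1) F B})
      > max 0 (int (tp.dim (forms_vanishing_on d Z)) - int ((d - 1 + 1) choose 2))" if B: "B \<in> U" for B
  proof -
    obtain u where u: "u \<in> B" "u \<noteq> 0" "tp_eval Q u \<noteq> 0"
      using B by (auto simp: U_def vanishes_at_def)
    obtain b where "B = range (\<lambda>t. t *s b)"
      using B proj_point_eq_span[of B] by (auto simp: U_def)
    with u have B_eq: "B = range (\<lambda>t. t *s u)" using range_scale_eqI[of u b] by auto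
    have Cu: "dot_prod c u \<noteq> 0" if "c \<in> C" for c using u(3) that by (auto simp: eval_Q)
    have general: "dot_prod (cross_prod (p i) (p j)) u \<noteq> 0" if "i < s" "j < s" "i \<noteq> j" for i j
      using that by (intro Cu) (auto simp: C_def)
    have Nu: "dot_prod (N L) u \<noteq> 0" if "L \<in> \<L>" for L
      unfolding N_def using IJ[OF that] by (intro general) (auto simp: S_def)
    have S: "S L \<subseteq> {..<s}" for L by (auto simp: S_def)
    obtain F where F: "F \<in> forms d" "F \<noteq> 0"
      "\<And>i. i < s \<Longrightarrow> vanishes_at F (range (\<lambda>t. t *s p i))"
      "vanishes_to_order (d - 1) F (range (\<lambda>t. t *s u))"
      using curve_with_singularity_at[where p = p and u = u and \<L> = \<L> and N = N and S = S,
          OF assms(1) s general fin Nu indep S line many] by blast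
    have "F \<in> forms_vanishing_on d Z"
      using F(1,3) p(2) by (auto simp: forms_vanishing_on_def Z)
    with F(4) B_eq have "F \<in> {F \<in> forms_vanishing_on d Z. vanishes_to_order (d - 1) F B}" by simp
    then have "0 < tp.dim {F \<in> forms_vanishing_on d Z. vanishes_to_order (d - 1) F B}"
      by (rule forms_dim_pos[rotated]) (use F(2) in \<open>auto simp: forms_vanishing_on_def\<close>)
    moreover have "card Z = s" unfolding assms(7) using card_image[OF assms(6)] by simp
    ultimately show ?thesis
      using assms(1,4,8) by (simp add: imposes_independent_conditions_def)
  qed
  ultimately show ?thesis
    unfolding admits_unexpected_curve_def by blast
qed

end
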